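(* Let $\Omega\subset\mathbb{R}^d$ ($d=2,3$) be a bounded polyhedral domain, $\kappa\in\mathbb{R}$, $\sigma\in\mathbb{R}$, $\sigma>0$, $V_h$ the first-order finite element space on a quasi-uniform triangulation of mesh size $h$ with nodal basis $\varphi_1,\dots,\varphi_n$, and $A_{j,i}=a(\varphi_i,\varphi_j)$, $K_{j,i}=(\nabla\varphi_i,\nabla\varphi_j)$, $M_{j,i}=(\varphi_i,\varphi_j)$. Let $\tilde K^{-N}$ denote the (linear) map $b\mapsto$ result of $N$ iterations, from zero initial guess, of a symmetric iterative method for $Kx=b$, define $E_N:V_h\to V_h$ by $x_{E_Nu}=(\tilde K^{-N}-K^{-1})Kx_u$, and assume there are $\gamma_0,\gamma_1\in[0,1)$ and $C>0$ independent of $\gamma_0,\gamma_1$ such that $\|E_Nu\|_1\le C\gamma_1^N\|u\|_1$ and $\|E_Nu\|_0\le C\gamma_0^N\|u\|_0$ for all $u\in V_h$. Then there exists a constant $C>0$, independent of $\gamma_0,\gamma_1,\kappa,h,\sigma$, such that $$\Re\,\mathcal{F}\big(A(\tilde K^{-N}-K^{-1})M\big)\subset\big[-Ch^d(\gamma_0^N+\kappa^2\gamma_1^N),\ Ch^d(\gamma_0^N+\kappa^2\gamma_1^N)\big]$$ and $$\Im\,\mathcal{F}\big(A(\tilde K^{-N}-K^{-1})M\big)\subset\big[-Ch^d(\gamma_0^N+\sigma\gamma_1^N),\ Ch^d(\gamma_0^N+\sigma\gamma_1^N)\big].$$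
   Context: $a(u,v)=(\nabla u,\nabla v)-\kappa^2(u,v)+\mathrm{i}\sigma(u,v)$ with $(u,v)=\int_\Omega u\bar v$. For $u\in V_h$, $x_u$ is its coefficient vector in the nodal basis. $\|\cdot\|_0,\|\cdot\|_1$ are the $L^2$ and $H^1$ norms. For $B\in\mathbb{C}^{n\times n}$, $\mathcal{F}(B)=\{x^*Bx/x^*x:\ x\neq0\}$, and $\Re\mathcal{F}(B)$, $\Im\mathcal{F}(B)$ denote the sets of real and imaginary parts of its elements. *)

theory Defs
  imports "HOL-Analysis.Analysis"
begin

definition polyhedral_domain :: "(real^'n) set \<Rightarrow> bool" where
  "polyhedral_domain \<Omega> \<longleftrightarrow> open \<Omega> \<and> connected \<Omega> \<and> bounded \<Omega> \<and> \<Omega> \<noteq> {} \<and>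
     interior (closure \<Omega>) = \<Omega> \<and>
     (\<exists>\<S>. finite \<S> \<and> (\<forall>S\<in>\<S>. polytope S) \<and> closure \<Omega> = \<Union>\<S>)"

definition mesh_of :: "(real^'n) set set \<Rightarrow> (real^'n) set \<Rightarrow> bool" where
  "mesh_of \<T> \<Omega> \<longleftrightarrow> triangulation \<T> \<and> \<T> \<noteq> {} \<and>
     (\<forall>T\<in>\<T>. (int CARD('n)) simplex T) \<and> \<Union>\<T> = closure \<Omega>"

definition meshsize :: "(real^'n) set set \<Rightarrow> real" where
  "meshsize \<T> = Max (diameter ` \<T>)"

text \<open>Quasi-uniformity with constant \<rho>: every element contains a ball of radius
\<rho> h (this implies shape regularity and comparable element sizes).\<close>
definition quasi_uniform :: "real \<Rightarrow> (real^'n) set set \<Rightarrow> bool" where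
  "quasi_uniform \<rho> \<T> \<longleftrightarrow> (\<forall>T\<in>\<T>. \<exists>x. ball x (\<rho> * meshsize \<T>) \<subseteq> T)"

definition mesh_vertices :: "(real^'n) set set \<Rightarrow> (real^'n) set" where
  "mesh_vertices \<T> = (\<Union>T\<in>\<T>. {v. v extreme_point_of T})"

text \<open>Degrees of freedom: interior vertices (homogeneous Dirichlet condition).\<close>
definition nodes :: "(real^'n) set set \<Rightarrow> (real^'n) set \<Rightarrow> (real^'n) set" where
  "nodes \<T> \<Omega> = mesh_vertices \<T> \<inter> \<Omega>"

text \<open>Continuous piecewise linear functions on the mesh, vanishing outside
\<Omega> (in particular on the boundary).  Continuity is automatic since the
function is single-valued on the shared faces.\<close>
definition Vh :: "(real^'n) set set \<Rightarrow> (real^'n) set \<Rightarrow> (real^'n \<Rightarrow> real) set" where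
  "Vh \<T> \<Omega> = {u. (\<forall>T\<in>\<T>. \<exists>a b. \<forall>x\<in>T. u x = a \<bullet> x + b) \<and> (\<forall>x. x \<notin> \<Omega> \<longrightarrow> u x = 0)}"

definition hat :: "(real^'n) set set \<Rightarrow> (real^'n) set \<Rightarrow> real^'n \<Rightarrow> (real^'n \<Rightarrow> real)" where
  "hat \<T> \<Omega> p = (THE u. u \<in> Vh \<T> \<Omega> \<and>
      (\<forall>q\<in>mesh_vertices \<T>. u q = (if q = p then 1 else 0)))"

definition coef :: "(real^'n) set set \<Rightarrow> (real^'n) set \<Rightarrow> (real^'n \<Rightarrow> real) \<Rightarrow> real^'n \<Rightarrow> real" where
  "coef \<T> \<Omega> u p = (if p \<in> nodes \<T> \<Omega> then u p else 0)"

text \<open>Gradient (defined almost everywhere for piecewise linear functions).\<close>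
definition grad :: "(real^'n \<Rightarrow> real) \<Rightarrow> real^'n \<Rightarrow> real^'n" where
  "grad u x = (SOME g. (u has_derivative (\<lambda>y. g \<bullet> y)) (at x))"

definition ip0 :: "(real^'n) set \<Rightarrow> (real^'n \<Rightarrow> real) \<Rightarrow> (real^'n \<Rightarrow> real) \<Rightarrow> real" where
  "ip0 \<Omega> u v = integral \<Omega> (\<lambda>x. u x * v x)"

definition ipgrad :: "(real^'n) set \<Rightarrow> (real^'n \<Rightarrow> real) \<Rightarrow> (real^'n \<Rightarrow> real) \<Rightarrow> real" where
  "ipgrad \<Omega> u v = integral \<Omega> (\<lambda>x. grad u x \<bullet> grad v x)"

definition norm0 :: "(real^'n) set \<Rightarrow> (real^'n \<Rightarrow> real) \<Rightarrow> real" where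
  "norm0 \<Omega> u = sqrt (ip0 \<Omega> u u)"

definition norm1 :: "(real^'n) set \<Rightarrow> (real^'n \<Rightarrow> real) \<Rightarrow> real" where
  "norm1 \<Omega> u = sqrt (ip0 \<Omega> u u + ipgrad \<Omega> u u)"

definition stiff :: "(real^'n) set set \<Rightarrow> (real^'n) set \<Rightarrow> real^'n \<Rightarrow> real^'n \<Rightarrow> real" where
  "stiff \<T> \<Omega> j i = ipgrad \<Omega> (hat \<T> \<Omega> i) (hat \<T> \<Omega> j)"

definition mass :: "(real^'n) set set \<Rightarrow> (real^'n) set \<Rightarrow> real^'n \<Rightarrow> real^'n \<Rightarrow> real" where
  "mass \<T> \<Omega> j i = ip0 \<Omega> (hat \<T> \<Omega> i) (hat \<T> \<Omega> j)"

text \<open>A j i = a(phi_i, phi_j) with a(u,v) = (grad u, grad v) - kappa^2 (u,v) + i sigma (u,v).\<close>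
definition helm :: "real \<Rightarrow> real \<Rightarrow> (real^'n) set set \<Rightarrow> (real^'n) set \<Rightarrow> real^'n \<Rightarrow> real^'n \<Rightarrow> complex" where
  "helm \<kappa> \<sigma> \<T> \<Omega> j i = complex_of_real (stiff \<T> \<Omega> j i) - complex_of_real (\<kappa>\<^sup>2 * mass \<T> \<Omega> j i)
      + \<i> * complex_of_real (\<sigma> * mass \<T> \<Omega> j i)"

definition matmul :: "'i set \<Rightarrow> ('i \<Rightarrow> 'i \<Rightarrow> 'a::comm_semiring_0) \<Rightarrow> ('i \<Rightarrow> 'i \<Rightarrow> 'a) \<Rightarrow> 'i \<Rightarrow> 'i \<Rightarrow> 'a" where
  "matmul I A B p q = (\<Sum>r\<in>I. A p r * B r q)"

definition matvec :: "'i set \<Rightarrow> ('i \<Rightarrow> 'i \<Rightarrow> 'a::comm_semiring_0) \<Rightarrow> ('i \<Rightarrow> 'a) \<Rightarrow> 'i \<Rightarrow> 'a" where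
  "matvec I A x p = (\<Sum>q\<in>I. A p q * x q)"

definition matinv :: "'i set \<Rightarrow> ('i \<Rightarrow> 'i \<Rightarrow> 'a::field) \<Rightarrow> 'i \<Rightarrow> 'i \<Rightarrow> 'a" where
  "matinv I A = (THE B. (\<forall>p\<in>I. \<forall>q\<in>I. matmul I A B p q = (if p = q then 1 else 0)) \<and>
                        (\<forall>p q. p \<notin> I \<or> q \<notin> I \<longrightarrow> B p q = 0))"

definition num_range :: "'i set \<Rightarrow> ('i \<Rightarrow> 'i \<Rightarrow> complex) \<Rightarrow> complex set" where
  "num_range I B = {(\<Sum>p\<in>I. \<Sum>q\<in>I. cnj (x p) * B p q * x q) / complex_of_real (\<Sum>p\<in>I. (cmod (x p))\<^sup>2)
                     | x. \<exists>p\<in>I. x p \<noteq> 0}"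

end

theory Submission
  imports Defs
begin

text \<open>Write \<open>D\<close> for the difference of \<open>Kt\<close> and the inverse of \<open>K\<close>, a symmetric matrix, and \<open>E = D K\<close>.  For
  a coefficient vector \<open>x\<close>, the form \<open>x\<^sup>* K D M x\<close> is the \<open>L\<^sup>2\<close> product of \<open>E x\<close> and \<open>x\<close>, hence
  at most \<open>CE \<gamma>0\<^sup>N\<close> times the squared \<open>L\<^sup>2\<close> norm of \<open>x\<close>.  The form \<open>x\<^sup>* M D M x\<close> is real; with \<open>y\<close> the
  solution of the discrete Poisson problem \<open>K y = M x\<close> it is the \<open>L\<^sup>2\<close> product of \<open>x\<close> and \<open>E y\<close>, hence at
  most \<open>CE \<gamma>1\<^sup>N\<close> times the product of the \<open>L\<^sup>2\<close> norm of \<open>x\<close> and the \<open>H\<^sup>1\<close> norm of \<open>y\<close>, and the latter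
  is controlled by the former through the Poincare inequality.  Finally the square of a finite element
  function at a point is at most the sum of the squares of its values at the nodes within distance
  \<open>h\<close>, so its squared \<open>L\<^sup>2\<close> norm is at most the volume of a ball of radius \<open>h\<close> times the squared
  Euclidean norm of its coefficients.\<close>

subsection \<open>Hat functions on a triangulation\<close>

lemma affine_le_on_convex_hull:
  fixes a :: "'a::euclidean_space"
  assumes "x \<in> convex hull C" and "\<And>c. c \<in> C \<Longrightarrow> a \<bullet> c + b \<le> s"
  shows "a \<bullet> x + b \<le> s"
proof -
  have "convex hull C \<subseteq> {x. a \<bullet> x \<le> s - b}"
    using assms(2) by (intro hull_minimal convex_halfspace_le) (auto simp: algebra_simps)
  then show ?thesis
    using assms(1) by (auto simp: algebra_simps)
qed

lemma abs_affine_le_on_convex_hull: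
  fixes a :: "'a::euclidean_space"
  assumes "x \<in> convex hull C" and "\<And>c. c \<in> C \<Longrightarrow> \<bar>a \<bullet> c + b\<bar> \<le> s"
  shows "\<bar>a \<bullet> x + b\<bar> \<le> s"
  using affine_le_on_convex_hull[OF assms(1), of a b s]
    affine_le_on_convex_hull[OF assms(1), of "-a" "-b" s] assms(2)
  by (fastforce simp: abs_le_iff)

lemma affine_eq_on_convex_hull:
  fixes a :: "'a::euclidean_space"
  assumes "x \<in> convex hull C" and "\<And>c. c \<in> C \<Longrightarrow> a \<bullet> c + b = a' \<bullet> c + b'"
  shows "a \<bullet> x + b = a' \<bullet> x + b'"
proof -
  have "\<bar>(a - a') \<bullet> x + (b - b')\<bar> \<le> 0"
    using assms(2) by (intro abs_affine_le_on_convex_hull[OF assms(1)]) (simp add: algebra_simps)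
  then show ?thesis
    by (simp add: algebra_simps)
qed

text \<open>Moving a base point \<open>c0\<close> to the origin turns affine into linear
  independence, so the increments \<open>f c - f c0\<close> extend to a linear functional, whose
  adjoint at 1 is the slope.\<close>

lemma affine_interpolation:
  fixes C :: "'a::euclidean_space set" and f :: "'a \<Rightarrow> real"
  assumes "\<not> affine_dependent C"
  shows "\<exists>a b. \<forall>c\<in>C. a \<bullet> c + b = f c"
proof (cases "C = {}")
  case False
  then obtain c0 where c0: "c0 \<in> C" by auto
  have "independent ((+) (- c0) ` (C - {c0}))"
    using assms c0 affine_dependent_iff_dependent2 by blast
  then obtain g where g: "linear g"
    and gf: "\<And>x. x \<in> (+) (- c0) ` (C - {c0}) \<Longrightarrow> g x = f (x + c0) - f c0"
    using linear_independent_extend[of _ "\<lambda>x. f (x + c0) - f c0"] by meson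
  have rep: "g x = adjoint g 1 \<bullet> x" for x
    using adjoint_works[OF g, of x 1] by (simp add: inner_commute)
  have "adjoint g 1 \<bullet> c + (f c0 - adjoint g 1 \<bullet> c0) = f c" if "c \<in> C" for c
  proof (cases "c = c0")
    case False
    then have "g (- c0 + c) = f c - f c0"
      using gf[of "- c0 + c"] that by auto
    then show ?thesis
      using rep[of "- c0 + c"] by (simp add: inner_diff_right)
  qed auto
  then show ?thesis by blast
qed auto

section \<open>Geometry of the triangulation\<close>

locale fe_mesh =
  fixes \<T> :: "(real^'n) set set" and \<Omega> :: "(real^'n) set"
  assumes dom: "polyhedral_domain \<Omega>" and mesh: "mesh_of \<T> \<Omega>"
begin

lemma finite_mesh: "finite \<T>"
  and Union_mesh: "\<Union>\<T> = closure \<Omega>"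
  and open_dom: "open \<Omega>"
  and bounded_dom: "bounded \<Omega>"
  and interior_closure_dom: "interior (closure \<Omega>) = \<Omega>"
  using dom mesh by (auto simp: polyhedral_domain_def mesh_of_def triangulation_def)

lemma mesh_simplex:
  assumes "T \<in> \<T>"
  obtains C where "finite C" "\<not> affine_dependent C" "T = convex hull C" "C = {v. v extreme_point_of T}"
proof -
  obtain C where C: "finite C" "\<not> affine_dependent C" "T = convex hull C"
    using assms mesh unfolding mesh_of_def simplex by blast
  then have "C = {v. v extreme_point_of T}"
    by (simp add: extreme_point_of_convex_hull_affine_independent)
  then show ?thesis
    using C that by blast
qed

lemma mesh_polytope: "T \<in> \<T> \<Longrightarrow> polytope T"
  using mesh simplex_imp_polytope unfolding mesh_of_def by blast

lemma mesh_convex: "T \<in> \<T> \<Longrightarrow> convex T"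
  and mesh_compact: "T \<in> \<T> \<Longrightarrow> compact T"
  and mesh_closed: "T \<in> \<T> \<Longrightarrow> closed T"
  by (auto simp: mesh_polytope polytope_imp_convex polytope_imp_compact polytope_imp_closed)

lemma mesh_Int_face: "T \<in> \<T> \<Longrightarrow> T' \<in> \<T> \<Longrightarrow> T \<inter> T' face_of T"
  using mesh by (auto simp: mesh_of_def triangulation_def)

lemma dom_covered: "x \<in> \<Omega> \<Longrightarrow> \<exists>T\<in>\<T>. x \<in> T"
  using Union_mesh closure_subset by blast

lemma mesh_interior_subset: "T \<in> \<T> \<Longrightarrow> interior T \<subseteq> \<Omega>"
  using Union_mesh interior_mono[of T "closure \<Omega>"] interior_closure_dom by auto

text \<open>Near each point of this set a finite element function is a single affine function, so
  its gradient can be computed there; the rest of the closed domain is a null set.\<close>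

definition skeleton_complement :: "(real^'n) set" where
  "skeleton_complement = (\<Union>T\<in>\<T>. interior T)"

lemma skeleton_complement_subset: "skeleton_complement \<subseteq> \<Omega>"
  using mesh_interior_subset by (auto simp: skeleton_complement_def)

lemma negligible_skeleton: "negligible (closure \<Omega> - skeleton_complement)"
proof (rule negligible_subset)
  show "negligible (\<Union>T\<in>\<T>. frontier T)"
    using finite_mesh mesh_convex negligible_convex_frontier by (intro negligible_Union) auto
  show "closure \<Omega> - skeleton_complement \<subseteq> (\<Union>T\<in>\<T>. frontier T)"
    using mesh_closed unfolding Union_mesh[symmetric] skeleton_complement_def frontier_def by auto
qed

text \<open>A proper face of a convex set avoids the interior, so it lies in the frontier, which is
  null. Two distinct elements cannot both equal their intersection, so it is a proper face of at
  least one of them.\<close>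

lemma negligible_mesh_Int:
  assumes "T \<in> \<T>" "T' \<in> \<T>" "T \<noteq> T'"
  shows "negligible (T \<inter> T')"
proof -
  have *: "negligible (S \<inter> S')" if "S \<in> \<T>" "S' \<in> \<T>" "S \<inter> S' \<noteq> S" for S S'
  proof (rule negligible_subset)
    show "negligible (frontier S)"
      using that mesh_convex negligible_convex_frontier by blast
    have "(S \<inter> S') \<inter> interior S = {}"
      using that mesh_Int_face face_of_disjoint_interior by blast
    then show "S \<inter> S' \<subseteq> frontier S"
      using mesh_closed[OF that(1)] by (auto simp: frontier_def)
  qed
  show ?thesis
    using *[of T T'] *[of T' T] assms by (metis inf.commute)
qed

lemma finite_mesh_vertices: "finite (mesh_vertices \<T>)"
  using finite_mesh mesh_polytope
  by (auto simp: mesh_vertices_def intro!: finite_polyhedron_extreme_points polytope_imp_polyhedron)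

lemma finite_nodes: "finite (nodes \<T> \<Omega>)"
  using finite_mesh_vertices by (auto simp: nodes_def)

text \<open>A simplex meeting the open segment contains both of its end points.  So the simplices covering a
  neighbourhood of a point of the segment close to \<open>c\<close> all contain \<open>z\<close>, and contracting towards \<open>z\<close>
  shows that they also cover a neighbourhood of \<open>x\<close>.\<close>
lemma open_segment_in_dom:
  assumes T: "T \<in> \<T>" "c \<in> T" "z \<in> T" and c: "c \<in> \<Omega>" and x: "x \<in> open_segment c z"
  shows "x \<in> \<Omega>"
proof -
  obtain t where t: "0 < t" "t < 1" and xt: "x = (1 - t) *\<^sub>R c + t *\<^sub>R z" and "c \<noteq> z"
    using x by (auto simp: in_segment)
  obtain e where e: "e > 0" "ball c e \<subseteq> \<Omega>"
    using open_dom c open_contains_ball by blast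
  \<comment> \<open>The first bound places \<open>y\<close> before \<open>x\<close> on the segment,
    the second keeps \<open>y\<close> inside the ball around \<open>c\<close>.\<close>
  define s where "s = min (t / 2) (e / (2 * dist c z))"
  have s: "0 < s" "s < t" "s * dist c z < e"
  proof -
    have "dist c z > 0" using \<open>c \<noteq> z\<close> by simp
    then show "0 < s" "s < t" using e t by (auto simp: s_def)
    have "s * dist c z \<le> e / (2 * dist c z) * dist c z"
      using \<open>dist c z > 0\<close> by (intro mult_right_mono) (auto simp: s_def)
    then show "s * dist c z < e" using \<open>dist c z > 0\<close> e by simp
  qed
  define y where "y = (1 - s) *\<^sub>R c + s *\<^sub>R z"
  have yc: "y - c = s *\<^sub>R (z - c)"
    by (simp add: y_def algebra_simps)
  have "dist c y = s * dist c z"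
    using s yc by (metis abs_of_pos dist_norm dist_commute norm_scaleR)
  then have y_dom: "y \<in> \<Omega>"
    using e s by auto
  have y_seg: "y \<in> open_segment c z"
    using s t \<open>c \<noteq> z\<close> by (auto simp: in_segment y_def)
  have yT: "y \<in> T"
    using y_seg T mesh_convex[OF T(1)] convex_contains_open_segment by blast
  have "open (\<Omega> - \<Union>{T'\<in>\<T>. y \<notin> T'})"
    using open_dom finite_mesh mesh_closed by (intro open_Diff closed_Union) auto
  then obtain d where d: "d > 0" "ball y d \<subseteq> \<Omega> - \<Union>{T'\<in>\<T>. y \<notin> T'}"
    using y_dom unfolding open_contains_ball by blast
  \<comment> \<open>The contraction towards \<open>z\<close> with factor \<open>1 - r\<close> maps
    \<open>y\<close> to \<open>x\<close>; the weights of \<open>c\<close> match by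
    \<open>r1\<close>.\<close>
  define r where "r = (t - s) / (1 - s)"
  have r: "0 \<le> r" "r < 1"
    using s t by (auto simp: r_def field_simps)
  have r1: "(1 - r) * (1 - s) = 1 - t"
    using s t by (simp add: r_def field_simps)
  have "ball x ((1 - r) * d) \<subseteq> closure \<Omega>"
  proof
    fix w assume w: "w \<in> ball x ((1 - r) * d)"
    define v where "v = (1 / (1 - r)) *\<^sub>R (w - x)"
    have "norm v < d"
    proof -
      have "norm v = norm (w - x) / (1 - r)"
        using r by (simp add: v_def divide_simps)
      then show ?thesis
        using w r by (simp add: dist_norm norm_minus_commute pos_divide_less_eq mult.commute)
    qed
    then have "y + v \<in> ball y d" by (simp add: dist_norm)
    then obtain T' where T': "T' \<in> \<T>" "y + v \<in> T'" "y \<in> T'"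
      using d dom_covered[of "y + v"] by blast
    have "z \<in> T'"
      using face_ofD[OF mesh_Int_face[OF T(1) T'(1)] y_seg T(2,3)] yT T' by blast
    then have "(1 - r) *\<^sub>R (y + v) + r *\<^sub>R z \<in> T'"
      using T' r mesh_convex by (intro convexD) auto
    moreover have "(1 - r) *\<^sub>R (y + v) + r *\<^sub>R z = w"
    proof -
      have "(1 - r) *\<^sub>R y + r *\<^sub>R z = ((1 - r) * (1 - s)) *\<^sub>R c + (1 - (1 - r) * (1 - s)) *\<^sub>R z"
        by (simp add: y_def algebra_simps)
      also have "\<dots> = x"
        unfolding r1 by (simp add: xt)
      finally show ?thesis
        using r by (simp add: v_def scaleR_add_right algebra_simps)
    qed
    ultimately show "w \<in> closure \<Omega>"
      using T' Union_mesh by auto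
  qed
  moreover have "(1 - r) * d > 0"
    using d r by auto
  ultimately show ?thesis
    using interior_closure_dom mem_interior by blast
qed

text \<open>Vertices inside \<open>\<Omega>\<close> are removed one at a time: a positive weight at
  such a vertex \<open>c\<close> would put \<open>x\<close> in the open segment from
  \<open>c\<close> to another point of \<open>T\<close>, hence into \<open>\<Omega>\<close> by
  \<open>open_segment_in_dom\<close>. Consequently an affine function vanishing at the exterior
  vertices vanishes on all of \<open>T\<close> outside \<open>\<Omega>\<close>.\<close>

lemma in_hull_exterior_vertices:
  assumes "T \<in> \<T>" and T: "T = convex hull C" "finite C" and x: "x \<in> T" "x \<notin> \<Omega>"
  shows "x \<in> convex hull (C - \<Omega>)"
proof -
  have "x \<in> convex hull (C - D)" if "finite D" "D \<subseteq> C \<inter> \<Omega>" for D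
    using that
  proof (induction D rule: finite_induct)
    case empty
    then show ?case using x T by simp
  next
    case (insert c D)
    then have IH: "x \<in> convex hull (C - D)" and c: "c \<in> C" "c \<in> \<Omega>" by auto
    have eq: "C - D = insert c (C - insert c D)" using insert by auto
    have ne: "C - insert c D \<noteq> {}"
    proof
      assume "C - insert c D = {}"
      with IH eq have "x \<in> convex hull {c}" by simp
      then show False using x c by simp
    qed
    obtain u v b where uv: "u \<ge> 0" "v \<ge> 0" "u + v = 1" and b: "b \<in> convex hull (C - insert c D)"
      and xe: "x = u *\<^sub>R c + v *\<^sub>R b"
      using IH unfolding eq convex_hull_insert[OF ne] by auto
    have cT: "c \<in> T" and bT: "b \<in> T"
      using b c T hull_mono[of "C - insert c D" C] by (auto simp: hull_inc)
    have "x \<noteq> c" using x c by auto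
    have "u = 0"
    proof (rule ccontr)
      assume "u \<noteq> 0"
      have "c \<noteq> b"
        using xe uv \<open>x \<noteq> c\<close> by (metis scaleR_add_left scaleR_one)
      moreover have "v \<noteq> 0"
        using xe uv \<open>x \<noteq> c\<close> by auto
      moreover have "u = 1 - v" using uv by simp
      ultimately have "x \<in> open_segment c b"
        using xe uv \<open>u \<noteq> 0\<close> unfolding in_segment by (intro conjI exI[of _ v]) auto
      then show False
        using open_segment_in_dom[OF assms(1) cT bT c(2)] x by auto
    qed
    then show ?case using xe uv b by simp
  qed
  from this[of "C \<inter> \<Omega>"] show ?thesis
    using T by (simp add: Diff_Int2 Int_commute Diff_Int)
qed

section \<open>Nodal interpolation in the finite element space\<close>

lemma Vh_affine:
  assumes "u \<in> Vh \<T> \<Omega>" "T \<in> \<T>"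
  obtains a b where "\<And>x. x \<in> T \<Longrightarrow> u x = a \<bullet> x + b"
  using assms unfolding Vh_def by blast

lemma Vh_zero: "u \<in> Vh \<T> \<Omega> \<Longrightarrow> x \<notin> \<Omega> \<Longrightarrow> u x = 0"
  by (auto simp: Vh_def)

text \<open>The affine interpolants on the single elements glue together: the extreme points of a
  common face are vertices of both elements, and by Krein-Milman they determine the values on it. A
  point of an element outside \<open>\<Omega>\<close> is a convex combination of exterior vertices,
  where \<open>f\<close> is zero.\<close>

lemma Vh_interpolation_exists:
  assumes f0: "\<And>p. p \<in> mesh_vertices \<T> \<Longrightarrow> p \<notin> \<Omega> \<Longrightarrow> f p = 0"
  shows "\<exists>u\<in>Vh \<T> \<Omega>. \<forall>p\<in>mesh_vertices \<T>. u p = f p"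
proof -
  have "\<exists>a b. \<forall>c. c extreme_point_of T \<longrightarrow> a \<bullet> c + b = f c" if "T \<in> \<T>" for T
  proof -
    obtain C where "\<not> affine_dependent C" "C = {v. v extreme_point_of T}"
      using mesh_simplex[OF \<open>T \<in> \<T>\<close>] by blast
    then show ?thesis
      using affine_interpolation[of C f] by auto
  qed
  then obtain a b where ab: "\<And>T c. T \<in> \<T> \<Longrightarrow> c extreme_point_of T \<Longrightarrow> a T \<bullet> c + b T = f c"
    by metis
  have agree: "a T \<bullet> x + b T = a T' \<bullet> x + b T'"
    if T: "T \<in> \<T>" "T' \<in> \<T>" and x: "x \<in> T" "x \<in> T'" for T T' x
  proof (rule affine_eq_on_convex_hull)
    have "compact (T \<inter> T')" "convex (T \<inter> T')"
      using T mesh_compact mesh_convex by (auto intro: compact_Int convex_Int)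
    then show "x \<in> convex hull {c. c extreme_point_of (T \<inter> T')}"
      using Krein_Milman_Minkowski x by blast
    fix c assume "c \<in> {c. c extreme_point_of (T \<inter> T')}"
    then have "c extreme_point_of T" "c extreme_point_of T'"
      using extreme_point_of_face[OF mesh_Int_face[OF T]]
        extreme_point_of_face[OF mesh_Int_face[OF T(2,1)]] by (auto simp: Int_commute)
    then show "a T \<bullet> c + b T = a T' \<bullet> c + b T'"
      using ab T by simp
  qed
  have boundary: "a T \<bullet> x + b T = 0" if T: "T \<in> \<T>" "x \<in> T" "x \<notin> \<Omega>" for T x
  proof -
    obtain C where C: "finite C" "T = convex hull C" "C = {v. v extreme_point_of T}"
      using mesh_simplex T by metis
    have "x \<in> convex hull (C - \<Omega>)"
      using in_hull_exterior_vertices T C by blast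
    then have "a T \<bullet> x + b T = 0 \<bullet> x + 0"
    proof (rule affine_eq_on_convex_hull)
      fix c assume "c \<in> C - \<Omega>"
      then have "c extreme_point_of T" "f c = 0"
        using C(3) T(1) f0[of c] unfolding mesh_vertices_def by blast+
      then show "a T \<bullet> c + b T = 0 \<bullet> c + 0"
        using ab T by simp
    qed
    then show ?thesis by simp
  qed
  \<comment> \<open>Any element containing \<open>x\<close> will do, since \<open>agree\<close>
    makes the value independent of the choice.\<close>
  define el where "el x = (SOME T. T \<in> \<T> \<and> x \<in> T)" for x
  define u where "u x = (if x \<in> \<Union>\<T> then a (el x) \<bullet> x + b (el x) else 0)" for x
  have u: "u x = a T \<bullet> x + b T" if "T \<in> \<T>" "x \<in> T" for x T
  proof -
    have "el x \<in> \<T> \<and> x \<in> el x"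
      unfolding el_def using that by (metis (mono_tags, lifting) someI_ex)
    then show ?thesis
      using agree[of "el x" T x] that unfolding u_def by auto
  qed
  have "u \<in> Vh \<T> \<Omega>"
    unfolding Vh_def
  proof (intro CollectI conjI ballI allI impI)
    show "\<exists>a b. \<forall>x\<in>T. u x = a \<bullet> x + b" if "T \<in> \<T>" for T
      using u that by blast
    show "u x = 0" if "x \<notin> \<Omega>" for x
    proof (cases "x \<in> \<Union>\<T>")
      case True
      then show ?thesis using u boundary that by auto
    qed (auto simp: u_def)
  qed
  moreover have "u p = f p" if "p \<in> mesh_vertices \<T>" for p
    using that ab u by (auto simp: mesh_vertices_def extreme_point_of_def)
  ultimately show ?thesis by blast
qed

text \<open>Vertices that are not nodes lie outside \<open>\<Omega>\<close>, where both functions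
  are zero. So they agree at all vertices, which determine them on every element.\<close>

lemma Vh_eqI:
  assumes "u \<in> Vh \<T> \<Omega>" "v \<in> Vh \<T> \<Omega>" and eq: "\<And>p. p \<in> nodes \<T> \<Omega> \<Longrightarrow> u p = v p"
  shows "u = v"
proof
  fix x
  show "u x = v x"
  proof (cases "x \<in> \<Omega>")
    case True
    then obtain T where T: "T \<in> \<T>" "x \<in> T" using dom_covered by blast
    obtain C where C: "T = convex hull C" "C = {v. v extreme_point_of T}"
      using mesh_simplex T by metis
    obtain a b a' b' where ab: "\<And>x. x \<in> T \<Longrightarrow> u x = a \<bullet> x + b" "\<And>x. x \<in> T \<Longrightarrow> v x = a' \<bullet> x + b'"
      using Vh_affine assms T by metis
    have "a \<bullet> x + b = a' \<bullet> x + b'"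
    proof (rule affine_eq_on_convex_hull)
      show "x \<in> convex hull C" using T(2) C(1) by simp
      fix c assume "c \<in> C"
      then have c: "c \<in> mesh_vertices \<T>" "c \<in> T"
        using C(2) T(1) unfolding mesh_vertices_def extreme_point_of_def by blast+
      then have "u c = v c"
        using eq[of c] Vh_zero[OF assms(1)] Vh_zero[OF assms(2)]
        by (cases "c \<in> \<Omega>") (auto simp: nodes_def)
      then show "a \<bullet> c + b = a' \<bullet> c + b'" using ab c by simp
    qed
    then show ?thesis using ab T by simp
  qed (use Vh_zero[OF assms(1)] Vh_zero[OF assms(2)] in auto)
qed

text \<open>This justifies the definite description in \<open>hat\<close>:
  \<open>Vh_interpolation_exists\<close> gives existence and \<open>Vh_eqI\<close>
  uniqueness.\<close>

lemma hat_props: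
  assumes "p \<in> nodes \<T> \<Omega>"
  shows hat_in_Vh: "hat \<T> \<Omega> p \<in> Vh \<T> \<Omega>"
    and hat_node: "q \<in> nodes \<T> \<Omega> \<Longrightarrow> hat \<T> \<Omega> p q = (if q = p then 1 else 0)"
proof -
  have "\<exists>u\<in>Vh \<T> \<Omega>. \<forall>q\<in>mesh_vertices \<T>. u q = (if q = p then 1 else 0)"
    using assms by (intro Vh_interpolation_exists) (auto simp: nodes_def)
  then obtain u where u: "u \<in> Vh \<T> \<Omega>" "\<And>q. q \<in> mesh_vertices \<T> \<Longrightarrow> u q = (if q = p then 1 else 0)"
    by blast
  have "hat \<T> \<Omega> p = u"
    unfolding hat_def
  proof (rule the_equality)
    show "v = u" if "v \<in> Vh \<T> \<Omega> \<and> (\<forall>q\<in>mesh_vertices \<T>. v q = (if q = p then 1 else 0))" for v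
      using that u by (intro Vh_eqI) (auto simp: nodes_def)
  qed (use u in auto)
  then show "hat \<T> \<Omega> p \<in> Vh \<T> \<Omega>"
    and "q \<in> nodes \<T> \<Omega> \<Longrightarrow> hat \<T> \<Omega> p q = (if q = p then 1 else 0)"
    using u by (auto simp: nodes_def)
qed

end

subsection \<open>Inner products on the finite element space\<close>

text \<open>The discriminant argument behind the Cauchy-Schwarz inequality for a possibly degenerate
  form; \<open>t = - B / C\<close> is the minimizer if \<open>C\<close> is positive.\<close>

lemma square_le_of_quadratic_nonneg:
  fixes A B C :: real
  assumes "\<And>t. 0 \<le> A + 2 * t * B + t\<^sup>2 * C" and "0 \<le> C"
  shows "B\<^sup>2 \<le> A * C"
proof (cases "C = 0")
  case True
  have "B = 0"
  proof (rule ccontr)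
    assume "B \<noteq> 0"
    \<comment> \<open>At this \<open>t\<close> the expression equals -1.\<close>
    then show False
      using assms(1)[of "- (A + 1) / (2 * B)"] True by (simp add: field_simps)
  qed
  then show ?thesis using True by simp
next
  case False
  then show ?thesis
    using assms(1)[of "- B / C"] assms(2) by (simp add: field_simps power2_eq_square)
qed

lemma lborel_integral_translation:
  fixes f :: "'a::euclidean_space \<Rightarrow> real"
  assumes "integrable lborel f"
  shows "integrable lborel (\<lambda>x. f (a + x))" "integral\<^sup>L lborel (\<lambda>x. f (a + x)) = integral\<^sup>L lborel f"
proof -
  have f: "f \<in> borel_measurable borel" using assms by auto
  have "integrable (distr lborel borel ((+) a)) f"
    using assms by (simp add: lborel_distr_plus)
  then show "integrable lborel (\<lambda>x. f (a + x))"
    using f by (subst (asm) integrable_distr_eq) auto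
  have "integral\<^sup>L (distr lborel borel ((+) a)) f = integral\<^sup>L lborel (\<lambda>x. f (a + x))"
    using f by (intro integral_distr) auto
  then show "integral\<^sup>L lborel (\<lambda>x. f (a + x)) = integral\<^sup>L lborel f"
    by (simp add: lborel_distr_plus)
qed

lemma integrable_lborel_compact_support:
  fixes f :: "'a::euclidean_space \<Rightarrow> real"
  assumes "continuous_on UNIV f" "compact K" "\<And>x. x \<notin> K \<Longrightarrow> f x = 0"
  shows "integrable lborel f"
proof -
  have "(\<lambda>x. indicat_real K x *\<^sub>R f x) = f"
    using assms(3) by (auto simp: fun_eq_iff indicator_def)
  then show ?thesis
    using borel_integrable_compact[OF assms(2) continuous_on_subset[OF assms(1)]] by simp
qed

text \<open>For an arbitrary function the integrand may fail to be integrable;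
  \<open>integral\<close> then has the default value 0.\<close>

lemma norm0_nonneg [simp]: "0 \<le> norm0 \<Omega> u"
  unfolding norm0_def ip0_def
  by (cases "(\<lambda>x. u x * u x) integrable_on \<Omega>")
    (auto intro!: integral_nonneg simp: not_integrable_integral)

lemma ip0_commute: "ip0 \<Omega> u v = ip0 \<Omega> v u"
  by (simp add: ip0_def mult.commute)

lemma ipgrad_commute: "ipgrad \<Omega> u v = ipgrad \<Omega> v u"
  by (simp add: ipgrad_def inner_commute)

lemma ip0_self_nonneg: "0 \<le> ip0 \<Omega> u u"
  using norm0_nonneg[of \<Omega> u] by (simp add: norm0_def)

lemma ipgrad_self_nonneg: "0 \<le> ipgrad \<Omega> u u"
  unfolding ipgrad_def
  by (cases "(\<lambda>x. grad u x \<bullet> grad u x) integrable_on \<Omega>")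
    (auto intro!: integral_nonneg simp: not_integrable_integral)

lemma norm0_le_norm1: "norm0 \<Omega> u \<le> norm1 \<Omega> u"
  using ipgrad_self_nonneg by (simp add: norm0_def norm1_def)

lemma mass_commute: "mass \<T> \<Omega> p q = mass \<T> \<Omega> q p"
  by (simp add: mass_def ip0_commute)

lemma stiff_commute: "stiff \<T> \<Omega> p q = stiff \<T> \<Omega> q p"
  by (simp add: stiff_def ipgrad_commute)

section \<open>Integrability, gradients and bilinearity\<close>

context fe_mesh begin

lemma negligible_dom_skeleton: "negligible (\<Omega> - skeleton_complement)"
  using closure_subset[of \<Omega>] by (intro negligible_subset[OF negligible_skeleton]) auto

text \<open>On each element the integrand agrees with a continuous function off the null frontier.
  The elements overlap in null sets, so their integrals add up over the closed domain, which differs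
  from \<open>\<Omega>\<close> by a null set.\<close>

lemma integrable_on_dom_piecewise:
  fixes f :: "real^'n \<Rightarrow> real"
  assumes f: "\<And>T. T \<in> \<T> \<Longrightarrow> \<exists>g. continuous_on UNIV g \<and> (\<forall>x\<in>interior T. f x = g x)"
  shows "f integrable_on \<Omega>"
proof -
  have fT: "f integrable_on T" if T: "T \<in> \<T>" for T
  proof -
    obtain g where g: "continuous_on UNIV g" "\<And>x. x \<in> interior T \<Longrightarrow> f x = g x"
      using f T by blast
    have "set_integrable lborel T g"
      unfolding set_integrable_def
      using borel_integrable_compact[OF mesh_compact[OF T] continuous_on_subset[OF g(1)]] by simp
    then have "g integrable_on T"
      by (rule set_borel_integral_eq_integral)
    then show ?thesis
    proof (rule integrable_spike)
      show "negligible (frontier T)"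
        using T mesh_convex negligible_convex_frontier by blast
      show "f x = g x" if "x \<in> T - frontier T" for x
        using that g closure_subset by (auto simp: frontier_def)
    qed
  qed
  have "(f has_integral (\<Sum>T\<in>\<T>. integral T f)) (\<Union>\<T>)"
    using fT finite_mesh negligible_mesh_Int
    by (intro has_integral_Union) (auto simp: pairwise_def)
  then have "f integrable_on closure \<Omega>"
    unfolding Union_mesh by blast
  moreover have "negligible (sym_diff (closure \<Omega>) \<Omega>)"
    using skeleton_complement_subset closure_subset[of \<Omega>]
    by (intro negligible_subset[OF negligible_skeleton]) auto
  ultimately show ?thesis
    using integrable_spike_set_eq by blast
qed

text \<open>\<open>grad\<close> picks some vector representing the derivative; uniqueness of the
  derivative at an interior point forces it to be the slope.\<close>

lemma grad_affine:
  assumes u: "\<And>x. x \<in> T \<Longrightarrow> u x = a \<bullet> x + b" and x: "x \<in> interior T"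
  shows "grad u x = a"
proof -
  have "(u has_derivative (\<lambda>y. a \<bullet> y)) (at x)"
  proof (rule has_derivative_transform_within_open)
    show "((\<lambda>x. a \<bullet> x + b) has_derivative (\<lambda>y. a \<bullet> y)) (at x)"
      by (auto intro!: derivative_eq_intros)
    show "a \<bullet> y + b = u y" if "y \<in> interior T" for y
      using that u interior_subset by fastforce
  qed (use x in auto)
  moreover from this have "(u has_derivative (\<lambda>y. grad u x \<bullet> y)) (at x)"
    unfolding grad_def by (rule someI)
  ultimately have "(\<lambda>y. a \<bullet> y) = (\<lambda>y. grad u x \<bullet> y)"
    by (rule has_derivative_unique)
  then show ?thesis
    by (metis vector_eq_rdot)
qed

lemma Vh_lincomb:
  assumes "\<And>p. p \<in> I \<Longrightarrow> \<phi> p \<in> Vh \<T> \<Omega>"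
  shows "(\<lambda>z. \<Sum>p\<in>I. c p * \<phi> p z) \<in> Vh \<T> \<Omega>"
proof -
  have "\<exists>a b. \<forall>x\<in>T. (\<Sum>p\<in>I. c p * \<phi> p x) = a \<bullet> x + b" if "T \<in> \<T>" for T
  proof -
    have "\<forall>p\<in>I. \<exists>a b. \<forall>x\<in>T. \<phi> p x = a \<bullet> x + b"
      using assms that unfolding Vh_def by blast
    then obtain a b where ab: "\<And>p x. p \<in> I \<Longrightarrow> x \<in> T \<Longrightarrow> \<phi> p x = a p \<bullet> x + b p"
      by metis
    have "(\<Sum>p\<in>I. c p * \<phi> p x) = (\<Sum>p\<in>I. c p *\<^sub>R a p) \<bullet> x + (\<Sum>p\<in>I. c p * b p)" if "x \<in> T" for x
      using ab that by (simp add: inner_sum_left sum.distrib[symmetric] algebra_simps)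
    then show ?thesis by blast
  qed
  then show ?thesis
    using assms by (auto simp: Vh_def)
qed

text \<open>Restricted to the open elements, because on the skeleton a derivative may not exist, and
  the arbitrary value of \<open>grad\<close> there need not be linear.\<close>

lemma grad_lincomb:
  assumes \<phi>: "\<And>p. p \<in> I \<Longrightarrow> \<phi> p \<in> Vh \<T> \<Omega>" and "x \<in> skeleton_complement"
  shows "grad (\<lambda>z. \<Sum>p\<in>I. c p * \<phi> p z) x = (\<Sum>p\<in>I. c p *\<^sub>R grad (\<phi> p) x)"
proof -
  obtain T where T: "T \<in> \<T>" "x \<in> interior T"
    using assms(2) by (auto simp: skeleton_complement_def)
  have "\<forall>p\<in>I. \<exists>a b. \<forall>x\<in>T. \<phi> p x = a \<bullet> x + b"
    using \<phi> T unfolding Vh_def by blast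
  then obtain a b where ab: "\<And>p x. p \<in> I \<Longrightarrow> x \<in> T \<Longrightarrow> \<phi> p x = a p \<bullet> x + b p"
    by metis
  have "grad (\<lambda>z. \<Sum>p\<in>I. c p * \<phi> p z) x = (\<Sum>p\<in>I. c p *\<^sub>R a p)"
    using T ab by (intro grad_affine[where b = "\<Sum>p\<in>I. c p * b p"])
      (auto simp: inner_sum_left sum.distrib[symmetric] algebra_simps)
  also have "\<dots> = (\<Sum>p\<in>I. c p *\<^sub>R grad (\<phi> p) x)"
    using ab grad_affine[OF _ T(2)] by (intro sum.cong) auto
  finally show ?thesis .
qed

lemma integrable_Vh_mult:
  assumes "u \<in> Vh \<T> \<Omega>" "v \<in> Vh \<T> \<Omega>"
  shows "(\<lambda>x. u x * v x) integrable_on \<Omega>"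
proof (rule integrable_on_dom_piecewise)
  fix T assume T: "T \<in> \<T>"
  obtain a b where u: "\<And>x. x \<in> T \<Longrightarrow> u x = a \<bullet> x + b"
    using Vh_affine[OF assms(1) T] by blast
  obtain a' b' where v: "\<And>x. x \<in> T \<Longrightarrow> v x = a' \<bullet> x + b'"
    using Vh_affine[OF assms(2) T] by blast
  have "continuous_on UNIV (\<lambda>x. (a \<bullet> x + b) * (a' \<bullet> x + b'))"
    by (intro continuous_intros)
  moreover have "\<forall>x\<in>interior T. u x * v x = (a \<bullet> x + b) * (a' \<bullet> x + b')"
    using u v interior_subset[of T] by (simp add: subset_iff)
  ultimately show "\<exists>g. continuous_on UNIV g \<and> (\<forall>x\<in>interior T. u x * v x = g x)"
    by blast
qed

lemma integrable_Vh_grad: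
  assumes "u \<in> Vh \<T> \<Omega>" "v \<in> Vh \<T> \<Omega>"
  shows "(\<lambda>x. grad u x \<bullet> grad v x) integrable_on \<Omega>"
proof (rule integrable_on_dom_piecewise)
  fix T assume T: "T \<in> \<T>"
  obtain a b where u: "\<And>x. x \<in> T \<Longrightarrow> u x = a \<bullet> x + b"
    using Vh_affine[OF assms(1) T] by blast
  obtain a' b' where v: "\<And>x. x \<in> T \<Longrightarrow> v x = a' \<bullet> x + b'"
    using Vh_affine[OF assms(2) T] by blast
  have "\<forall>x\<in>interior T. grad u x \<bullet> grad v x = a \<bullet> a'"
    using grad_affine[of T u] grad_affine[of T v] u v by metis
  then show "\<exists>g. continuous_on UNIV g \<and> (\<forall>x\<in>interior T. grad u x \<bullet> grad v x = g x)"
    using continuous_on_const by (intro exI[of _ "\<lambda>_. a \<bullet> a'"]) auto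
qed

lemma ip0_lincomb_left:
  assumes "finite I" "\<And>p. p \<in> I \<Longrightarrow> \<phi> p \<in> Vh \<T> \<Omega>" "v \<in> Vh \<T> \<Omega>"
  shows "ip0 \<Omega> (\<lambda>z. \<Sum>p\<in>I. c p * \<phi> p z) v = (\<Sum>p\<in>I. c p * ip0 \<Omega> (\<phi> p) v)"
proof -
  have "ip0 \<Omega> (\<lambda>z. \<Sum>p\<in>I. c p * \<phi> p z) v = integral \<Omega> (\<lambda>z. \<Sum>p\<in>I. c p * (\<phi> p z * v z))"
    by (simp add: ip0_def sum_distrib_right mult.assoc)
  also have "\<dots> = (\<Sum>p\<in>I. integral \<Omega> (\<lambda>z. c p * (\<phi> p z * v z)))"
    using assms by (intro integral_sum integrable_on_mult_right integrable_Vh_mult)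
  finally show ?thesis by (simp add: ip0_def)
qed

lemma ipgrad_lincomb_left:
  assumes "finite I" "\<And>p. p \<in> I \<Longrightarrow> \<phi> p \<in> Vh \<T> \<Omega>" "v \<in> Vh \<T> \<Omega>"
  shows "ipgrad \<Omega> (\<lambda>z. \<Sum>p\<in>I. c p * \<phi> p z) v = (\<Sum>p\<in>I. c p * ipgrad \<Omega> (\<phi> p) v)"
proof -
  have "ipgrad \<Omega> (\<lambda>z. \<Sum>p\<in>I. c p * \<phi> p z) v
      = integral \<Omega> (\<lambda>z. \<Sum>p\<in>I. c p * (grad (\<phi> p) z \<bullet> grad v z))"
    unfolding ipgrad_def
  proof (rule integral_spike[OF negligible_dom_skeleton])
    fix x assume "x \<in> \<Omega> - (\<Omega> - skeleton_complement)"
    then have "grad (\<lambda>z. \<Sum>p\<in>I. c p * \<phi> p z) x = (\<Sum>p\<in>I. c p *\<^sub>R grad (\<phi> p) x)"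
      using assms by (intro grad_lincomb) auto
    then show "(\<Sum>p\<in>I. c p * (grad (\<phi> p) x \<bullet> grad v x)) = grad (\<lambda>z. \<Sum>p\<in>I. c p * \<phi> p z) x \<bullet> grad v x"
      by (simp add: inner_sum_left)
  qed
  also have "\<dots> = (\<Sum>p\<in>I. integral \<Omega> (\<lambda>z. c p * (grad (\<phi> p) z \<bullet> grad v z)))"
    using assms by (intro integral_sum integrable_on_mult_right integrable_Vh_grad)
  finally show ?thesis by (simp add: ipgrad_def)
qed

lemma ip0_Cauchy_Schwarz:
  assumes u: "u \<in> Vh \<T> \<Omega>" and v: "v \<in> Vh \<T> \<Omega>"
  shows "\<bar>ip0 \<Omega> u v\<bar> \<le> norm0 \<Omega> u * norm0 \<Omega> v"
proof -
  have "0 \<le> ip0 \<Omega> u u + 2 * t * ip0 \<Omega> u v + t\<^sup>2 * ip0 \<Omega> v v" for t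
  proof -
    have "0 \<le> integral \<Omega> (\<lambda>x. (u x + t * v x)\<^sup>2)"
      by (cases "(\<lambda>x. (u x + t * v x)\<^sup>2) integrable_on \<Omega>")
        (auto intro!: integral_nonneg simp: not_integrable_integral)
    also have "(\<lambda>x. (u x + t * v x)\<^sup>2) = (\<lambda>x. u x * u x + (2 * t) * (u x * v x) + t\<^sup>2 * (v x * v x))"
      by (auto simp: power2_eq_square algebra_simps)
    also have "integral \<Omega> \<dots> = ip0 \<Omega> u u + 2 * t * ip0 \<Omega> u v + t\<^sup>2 * ip0 \<Omega> v v"
      using integrable_Vh_mult[OF u u] integrable_Vh_mult[OF u v] integrable_Vh_mult[OF v v]
      unfolding ip0_def
      by (simp add: integral_add integrable_add integrable_on_mult_right)
    finally show ?thesis .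
  qed
  then have "(ip0 \<Omega> u v)\<^sup>2 \<le> ip0 \<Omega> u u * ip0 \<Omega> v v"
    by (rule square_le_of_quadratic_nonneg) (rule ip0_self_nonneg)
  then show ?thesis
    unfolding norm0_def by (metis real_sqrt_abs real_sqrt_le_mono real_sqrt_mult)
qed

section \<open>Mesh size and bounds by nodal values\<close>

lemma meshsize_bound:
  assumes "T \<in> \<T>" "x \<in> T" "y \<in> T"
  shows "dist x y \<le> meshsize \<T>"
proof -
  have "dist x y \<le> diameter T"
    using assms mesh_compact compact_imp_bounded diameter_bounded_bound by blast
  also have "\<dots> \<le> meshsize \<T>"
    using assms finite_mesh by (auto simp: meshsize_def)
  finally show ?thesis .
qed

lemma meshsize_nonneg: "0 \<le> meshsize \<T>"
proof -
  obtain x T where "T \<in> \<T>" "x \<in> T"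
    using dom dom_covered by (force simp: polyhedral_domain_def)
  then show ?thesis using meshsize_bound[of T x x] by simp
qed

text \<open>On the element containing \<open>x\<close>, the modulus of an affine function is bounded
  by its largest vertex value. Each vertex is within one mesh size of \<open>x\<close>, and
  \<open>u\<close> vanishes at those that are not nodes.\<close>

lemma Vh_square_le:
  assumes u: "u \<in> Vh \<T> \<Omega>"
  shows "(u x)\<^sup>2 \<le> (\<Sum>p\<in>nodes \<T> \<Omega>. (u p)\<^sup>2 * indicator (cball p (meshsize \<T>)) x)"
proof (cases "x \<in> \<Omega>")
  case False
  then show ?thesis
    using Vh_zero[OF u] by (auto intro!: sum_nonneg)
next
  case True
  then obtain T where T: "T \<in> \<T>" "x \<in> T" using dom_covered by blast
  obtain C where C: "T = convex hull C" "C = {v. v extreme_point_of T}"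
    using mesh_simplex T by metis
  obtain a b where ab: "\<And>x. x \<in> T \<Longrightarrow> u x = a \<bullet> x + b"
    using Vh_affine[OF u T(1)] by blast
  define S where "S = (\<Sum>p\<in>nodes \<T> \<Omega>. (u p)\<^sup>2 * indicator (cball p (meshsize \<T>)) x)"
  have S: "0 \<le> S"
    by (auto simp: S_def intro!: sum_nonneg)
  have "\<bar>a \<bullet> x + b\<bar> \<le> sqrt S"
  proof (rule abs_affine_le_on_convex_hull)
    show "x \<in> convex hull C" using T(2) C(1) by simp
    fix c assume "c \<in> C"
    then have c: "c \<in> mesh_vertices \<T>" "c \<in> T"
      using C(2) T(1) unfolding mesh_vertices_def extreme_point_of_def by blast+
    have "\<bar>u c\<bar> \<le> sqrt S"
    proof (cases "c \<in> \<Omega>")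
      case True
      have "(u c)\<^sup>2 * indicator (cball c (meshsize \<T>)) x \<le> S"
        unfolding S_def using True c finite_nodes
        by (intro member_le_sum) (auto simp: nodes_def)
      then have "(u c)\<^sup>2 \<le> S"
        using meshsize_bound[OF T(1) c(2) T(2)] by (simp add: indicator_def)
      then show ?thesis
        using real_le_rsqrt by (metis power2_abs)
    qed (use S Vh_zero[OF u] in auto)
    then show "\<bar>a \<bullet> c + b\<bar> \<le> sqrt S" using ab c by simp
  qed
  then have "\<bar>u x\<bar> \<le> sqrt S" using ab T by simp
  then have "(u x)\<^sup>2 \<le> S"
    using S by (metis abs_ge_zero power2_abs power_mono real_sqrt_pow2)
  then show ?thesis by (simp add: S_def)
qed

lemma Vh_bounded:
  assumes u: "u \<in> Vh \<T> \<Omega>"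
  obtains B where "\<And>x. \<bar>u x\<bar> \<le> B"
proof -
  have "\<bar>u x\<bar> \<le> sqrt (\<Sum>p\<in>nodes \<T> \<Omega>. (u p)\<^sup>2)" for x
  proof (rule real_le_rsqrt)
    have "(u x)\<^sup>2 \<le> (\<Sum>p\<in>nodes \<T> \<Omega>. (u p)\<^sup>2)"
      using Vh_square_le[OF u, of x] by (rule order_trans) (auto intro!: sum_mono simp: indicator_def)
    then show "\<bar>u x\<bar>\<^sup>2 \<le> (\<Sum>p\<in>nodes \<T> \<Omega>. (u p)\<^sup>2)" by simp
  qed
  then show ?thesis using that by blast
qed

lemma ip0_self_le_nodes:
  assumes u: "u \<in> Vh \<T> \<Omega>"
  shows "ip0 \<Omega> u u \<le> unit_ball_vol (real CARD('n)) * meshsize \<T> ^ CARD('n) * (\<Sum>p\<in>nodes \<T> \<Omega>. (u p)\<^sup>2)"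
proof -
  define h where "h = meshsize \<T>"
  have ball: "((\<lambda>x. (u p)\<^sup>2 * indicator (cball p h) x) has_integral (u p)\<^sup>2 * measure lborel (cball p h)) UNIV" for p
  proof -
    have "integrable lborel (indicat_real (cball p h))"
      using borel_integrable_compact[of "cball p h" "\<lambda>_. 1::real"] by simp
    from has_integral_integral_lborel[OF this] show ?thesis
      by (intro has_integral_mult_right) simp
  qed
  have "((\<lambda>x. u x * u x) has_integral ip0 \<Omega> u u) \<Omega>"
    unfolding ip0_def using integrable_Vh_mult[OF u u] by (rule integrable_integral)
  \<comment> \<open>Extension by zero to the whole space, since the balls around the nodes may leave
    \<open>\<Omega>\<close>.\<close>
  then have "((\<lambda>x. u x * u x) has_integral ip0 \<Omega> u u) UNIV"
    by (rule has_integral_on_superset) (use Vh_zero[OF u] in auto)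
  moreover have "((\<lambda>x. \<Sum>p\<in>nodes \<T> \<Omega>. (u p)\<^sup>2 * indicator (cball p h) x) has_integral
      (\<Sum>p\<in>nodes \<T> \<Omega>. (u p)\<^sup>2 * measure lborel (cball p h))) UNIV"
    using ball finite_nodes by (intro has_integral_sum)
  ultimately have "ip0 \<Omega> u u \<le> (\<Sum>p\<in>nodes \<T> \<Omega>. (u p)\<^sup>2 * measure lborel (cball p h))"
    by (rule has_integral_le) (use Vh_square_le[OF u] in \<open>auto simp: power2_eq_square h_def\<close>)
  also have "\<dots> = unit_ball_vol (real CARD('n)) * h ^ CARD('n) * (\<Sum>p\<in>nodes \<T> \<Omega>. (u p)\<^sup>2)"
    using meshsize_nonneg by (simp add: content_cball h_def sum_distrib_left mult_ac)
  finally show ?thesis by (simp add: h_def)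
qed

section \<open>Continuity and Lipschitz bounds\<close>

lemma Vh_continuous:
  assumes u: "u \<in> Vh \<T> \<Omega>"
  shows "continuous_on UNIV u"
proof -
  have "continuous_on T u" if T: "T \<in> \<T>" for T
  proof -
    obtain a b where ab: "\<And>x. x \<in> T \<Longrightarrow> u x = a \<bullet> x + b"
      using Vh_affine[OF u T] by blast
    have "continuous_on T (\<lambda>x. a \<bullet> x + b)" by (intro continuous_intros)
    then show ?thesis using ab by (simp cong: continuous_on_cong)
  qed
  then have "continuous_on (\<Union>((\<lambda>T. T) ` \<T>)) u"
    using finite_mesh mesh_closed by (intro continuous_on_closed_Union)
  then have "continuous_on (closure \<Omega>) u"
    using Union_mesh by simp
  moreover have "continuous_on (- \<Omega>) u"
    using Vh_zero[OF u] by (intro continuous_on_eq[OF continuous_on_const[of _ 0]]) auto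
  ultimately have "continuous_on (closure \<Omega> \<union> - \<Omega>) u"
    using open_dom by (intro continuous_on_closed_Un) (auto simp: closed_Compl)
  moreover have "closure \<Omega> \<union> - \<Omega> = UNIV"
    using closure_subset by blast
  ultimately show ?thesis by simp
qed

text \<open>The elements and the complement of \<open>\<Omega>\<close> cut a line into finitely many
  closed pieces. On each of them \<open>u\<close> is Lipschitz, and such bounds combine over a
  finite closed cover of an interval. The estimate dominates the difference quotients in
  \<open>ip0_self_eq_directional\<close>.\<close>

lemma Vh_Lipschitz_on_lines:
  assumes u: "u \<in> Vh \<T> \<Omega>" and e: "norm e = 1"
  shows "\<exists>L\<ge>0. \<forall>x t. 0 \<le> t \<longrightarrow> \<bar>u (x + t *\<^sub>R e) - u x\<bar> \<le> L * t"
proof -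
  obtain a b where ab: "\<And>T x. T \<in> \<T> \<Longrightarrow> x \<in> T \<Longrightarrow> u x = a T \<bullet> x + b T"
    using u unfolding Vh_def by (auto simp: Ball_def) metis
  \<comment> \<open>The sum is a convenient common bound for the finitely many slopes.\<close>
  define L where "L = (\<Sum>T\<in>\<T>. norm (a T))"
  have L: "0 \<le> L" by (auto simp: L_def intro: sum_nonneg)
  have aL: "norm (a T) \<le> L" if "T \<in> \<T>" for T
    unfolding L_def using that finite_mesh by (intro member_le_sum) auto
  have "\<bar>u (x + t *\<^sub>R e) - u x\<bar> \<le> L * t" if t: "0 \<le> t" for x t
  proof -
    define g where "g = (\<lambda>s. u (x + s *\<^sub>R e))"
    define U where "U S = (\<lambda>s. x + s *\<^sub>R e) -` S" for S
    have "L-lipschitz_on {0..t} g"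
    proof (rule lipschitz_on_closed_Union[where I = "insert (- \<Omega>) \<T>" and U = U])
      fix S assume S: "S \<in> insert (- \<Omega>) \<T>"
      then have "closed S" using open_dom mesh_closed by auto
      then show "closed (U S)"
        unfolding U_def by (intro closed_vimage) (auto intro!: continuous_intros)
      show "L-lipschitz_on (U S) g"
      proof (cases "S \<in> \<T>")
        case True
        show ?thesis
        proof (rule lipschitz_onI)
          fix s r assume sr: "s \<in> U S" "r \<in> U S"
          have "g s - g r = (s - r) * (a S \<bullet> e)"
            using sr ab[OF True] by (auto simp: g_def U_def algebra_simps)
          then have "dist (g s) (g r) = \<bar>s - r\<bar> * \<bar>a S \<bullet> e\<bar>"
            by (simp add: dist_real_def abs_mult)
          also have "\<dots> \<le> \<bar>s - r\<bar> * L"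
            using Cauchy_Schwarz_ineq2[of "a S" e] e aL[OF True] by (intro mult_left_mono) auto
          finally show "dist (g s) (g r) \<le> L * dist s r"
            by (simp add: dist_real_def mult.commute)
        qed (rule L)
      next
        case False
        then have "S = - \<Omega>" using S by auto
        then show ?thesis
          using L Vh_zero[OF u] by (auto intro!: lipschitz_onI simp: g_def U_def)
      qed
    next
      show "{0..t} \<subseteq> \<Union> (U ` insert (- \<Omega>) \<T>)"
        using dom_covered by (fastforce simp: U_def)
    qed (use finite_mesh L in auto)
    then have "dist (g t) (g 0) \<le> L * dist t 0"
      using t by (intro lipschitz_onD) auto
    then show ?thesis using t by (simp add: g_def dist_real_def)
  qed
  then show ?thesis using L by blast
qed

end

subsection \<open>The Poincare inequality\<close>

context fe_mesh begin

text \<open>The integral of \<open>(x \<bullet> e) (u x)\<^sup>2\<close> is translation invariant.  Written with difference quotients in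
  the direction \<open>e\<close>, this is a discrete form of the claim; dominated convergence gives the limit.\<close>
lemma ip0_self_eq_directional:
  assumes u: "u \<in> Vh \<T> \<Omega>" and e: "norm e = 1"
  shows "((\<lambda>x. 2 * (x \<bullet> e) * u x * (grad u x \<bullet> e)) has_integral - ip0 \<Omega> u u) \<Omega>"
proof -
  obtain B where B: "\<And>x. \<bar>u x\<bar> \<le> B" using Vh_bounded[OF u] by blast
  obtain L where L: "0 \<le> L" "\<And>x t. 0 \<le> t \<Longrightarrow> \<bar>u (x + t *\<^sub>R e) - u x\<bar> \<le> L * t"
    using Vh_Lipschitz_on_lines[OF assms] by auto
  obtain R where R: "\<And>x. x \<in> \<Omega> \<Longrightarrow> norm x \<le> R"
    using bounded_dom bounded_iff by blast
  have B0: "0 \<le> B" using B[of 0] by simp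
  note cont = Vh_continuous[OF u]
  define \<tau> where "\<tau> n = 1 / real (Suc n)" for n
  have \<tau>: "0 < \<tau> n" "\<tau> n \<le> 1" for n by (auto simp: \<tau>_def divide_simps)
  have \<tau>0: "\<tau> \<longlonglongrightarrow> 0"
    unfolding \<tau>_def by (rule LIMSEQ_Suc) (rule lim_1_over_n)
  define F where "F x = (x \<bullet> e) * (u x)\<^sup>2" for x
  define f where "f n x = (x \<bullet> e) * ((u (x + \<tau> n *\<^sub>R e))\<^sup>2 - (u x)\<^sup>2) / \<tau> n" for n x
  define g where "g x = (if x \<in> \<Omega> then 2 * (x \<bullet> e) * u x * (grad u x \<bullet> e) else 0)" for x
  define N where "N = closure \<Omega> - skeleton_complement"
  have compact: "compact (closure \<Omega>)" using bounded_dom by simp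
  have F_int: "integrable lborel F"
    unfolding F_def using Vh_zero[OF u] closure_subset[of \<Omega>]
    by (intro integrable_lborel_compact_support[OF _ compact])
      (auto intro!: continuous_intros cont continuous_on_compose2[OF cont])
  have u2_int: "integrable lborel (\<lambda>x. (u x)\<^sup>2)"
    using Vh_zero[OF u] closure_subset[of \<Omega>]
    by (intro integrable_lborel_compact_support[OF _ compact])
      (auto intro!: continuous_intros cont)
  have u2: "integral\<^sup>L lborel (\<lambda>x. (u x)\<^sup>2) = ip0 \<Omega> u u"
  proof -
    have "((\<lambda>x. u x * u x) has_integral ip0 \<Omega> u u) \<Omega>"
      unfolding ip0_def using integrable_Vh_mult[OF u u] by (rule integrable_integral)
    then have "((\<lambda>x. u x * u x) has_integral ip0 \<Omega> u u) UNIV"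
      by (rule has_integral_on_superset) (use Vh_zero[OF u] in auto)
    then show ?thesis
      using has_integral_integral_lborel[OF u2_int] by (auto simp: power2_eq_square dest: has_integral_unique)
  qed
  have f_UNIV: "(f n has_integral - ip0 \<Omega> u u) UNIV" for n
  proof -
    \<comment> \<open>A discrete product rule: as \<open>e\<close> is a unit vector, the shift
      raises the weight \<open>x \<bullet> e\<close> by exactly \<open>\<tau> n\<close>. By
      translation invariance the first term integrates to zero, the second to
      \<open>- ip0 \<Omega> u u\<close>.\<close>
    have f_eq: "f n = (\<lambda>x. (F (\<tau> n *\<^sub>R e + x) - F x) / \<tau> n - (u (\<tau> n *\<^sub>R e + x))\<^sup>2)"
    proof
      fix x
      have "e \<bullet> e = 1" using e by (simp add: dot_square_norm)
      then show "f n x = (F (\<tau> n *\<^sub>R e + x) - F x) / \<tau> n - (u (\<tau> n *\<^sub>R e + x))\<^sup>2"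
        using \<tau>[of n] by (simp add: f_def F_def field_simps inner_add_left)
    qed
    note F' = lborel_integral_translation[OF F_int, of "\<tau> n *\<^sub>R e"]
    note u' = lborel_integral_translation[OF u2_int, of "\<tau> n *\<^sub>R e"]
    have "integrable lborel (f n)"
      unfolding f_eq using F' u' F_int by (intro Bochner_Integration.integrable_diff integrable_divide) auto
    moreover have "integral\<^sup>L lborel (f n) = - ip0 \<Omega> u u"
      unfolding f_eq using F' u' F_int u2 by simp
    ultimately show ?thesis
      using has_integral_integral_lborel by metis
  qed
  have N: "negligible N" unfolding N_def by (rule negligible_skeleton)
  have lim: "(\<lambda>n. f n x) \<longlonglongrightarrow> g x" if x: "x \<in> UNIV - N" for x
  proof -
    have near: "(\<lambda>n. x + \<tau> n *\<^sub>R e) \<longlonglongrightarrow> x"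
      using tendsto_add[OF tendsto_const[of x] tendsto_scaleR[OF \<tau>0 tendsto_const[of e]]] by simp
    show ?thesis
    proof (cases "x \<in> closure \<Omega>")
      case True
      then obtain T where T: "T \<in> \<T>" "x \<in> interior T"
        using x by (auto simp: N_def skeleton_complement_def)
      obtain a b where ab: "\<And>x. x \<in> T \<Longrightarrow> u x = a \<bullet> x + b"
        using Vh_affine[OF u T(1)] by blast
      have ga: "grad u x = a" using grad_affine[OF ab T(2)] .
      have x\<Omega>: "x \<in> \<Omega>" and xT: "x \<in> T" using T mesh_interior_subset interior_subset by blast+
      have "eventually (\<lambda>n. x + \<tau> n *\<^sub>R e \<in> interior T) sequentially"
        using near T(2) open_interior by (metis topological_tendstoD)
      then have "eventually (\<lambda>n. (x \<bullet> e) * (2 * u x * (a \<bullet> e) + \<tau> n * (a \<bullet> e)\<^sup>2) = f n x) sequentially"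
      proof eventually_elim
        case (elim n)
        then have "u (x + \<tau> n *\<^sub>R e) = u x + \<tau> n * (a \<bullet> e)"
          using ab interior_subset[of T] xT by (simp add: subset_iff inner_add_right)
        then have "(u (x + \<tau> n *\<^sub>R e))\<^sup>2 - (u x)\<^sup>2 = (2 * u x * (a \<bullet> e) + \<tau> n * (a \<bullet> e)\<^sup>2) * \<tau> n"
          by (simp add: power2_eq_square algebra_simps)
        then show ?case using \<tau>[of n] by (simp add: f_def)
      qed
      moreover have "(\<lambda>n. (x \<bullet> e) * (2 * u x * (a \<bullet> e) + \<tau> n * (a \<bullet> e)\<^sup>2)) \<longlonglongrightarrow> (x \<bullet> e) * (2 * u x * (a \<bullet> e) + 0 * (a \<bullet> e)\<^sup>2)"
        by (intro tendsto_intros \<tau>0)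
      ultimately have "(\<lambda>n. f n x) \<longlonglongrightarrow> (x \<bullet> e) * (2 * u x * (a \<bullet> e) + 0 * (a \<bullet> e)\<^sup>2)"
        by (rule Lim_transform_eventually[rotated])
      then show ?thesis
        using x\<Omega> ga by (simp add: g_def mult_ac)
    next
      case False
      then have "eventually (\<lambda>n. x + \<tau> n *\<^sub>R e \<in> - closure \<Omega>) sequentially"
        using near by (intro topological_tendstoD) auto
      then have "eventually (\<lambda>n. 0 = f n x) sequentially"
      proof eventually_elim
        case (elim n)
        then have "x + \<tau> n *\<^sub>R e \<notin> \<Omega>" "x \<notin> \<Omega>"
          using False closure_subset[of \<Omega>] by auto
        then show ?case
          using Vh_zero[OF u] by (simp add: f_def)
      qed
      then have "(\<lambda>n. f n x) \<longlonglongrightarrow> 0"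
        by (rule Lim_transform_eventually[OF tendsto_const])
      then show ?thesis
        using False closure_subset[of \<Omega>] by (auto simp: g_def)
    qed
  qed
  \<comment> \<open>On the ball the weight is at most \<open>R + 1\<close>, the sum of the two
    values of \<open>u\<close> at most \<open>2 * B\<close> and their difference at most
    \<open>L * \<tau> n\<close>. Shifts have length at most 1, so outside the ball of radius
    \<open>R + 1\<close> both points miss \<open>\<Omega>\<close> and the quotient is zero.\<close>
  define D where "D = (R + 1) * (2 * B * L)"
  define h where "h x = D * indicator (cball 0 (R + 1)) x" for x :: "real^'n"
  have bound: "norm (f n x) \<le> h x" for n x
  proof (cases "x \<in> cball 0 (R + 1)")
    case True
    then have xR: "norm x \<le> R + 1" by simp
    have "\<bar>x \<bullet> e\<bar> \<le> R + 1"
      using Cauchy_Schwarz_ineq2[of x e] e xR by simp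
    moreover have "\<bar>(u (x + \<tau> n *\<^sub>R e))\<^sup>2 - (u x)\<^sup>2\<bar> \<le> (2 * B) * (L * \<tau> n)"
    proof -
      have "(u (x + \<tau> n *\<^sub>R e))\<^sup>2 - (u x)\<^sup>2 = (u (x + \<tau> n *\<^sub>R e) + u x) * (u (x + \<tau> n *\<^sub>R e) - u x)"
        by (simp add: power2_eq_square algebra_simps)
      moreover have "\<bar>u (x + \<tau> n *\<^sub>R e) + u x\<bar> \<le> 2 * B"
        using B[of x] B[of "x + \<tau> n *\<^sub>R e"] by linarith
      moreover have "\<bar>u (x + \<tau> n *\<^sub>R e) - u x\<bar> \<le> L * \<tau> n"
        using L(2)[of "\<tau> n" x] \<tau>[of n] by simp
      ultimately show ?thesis
        using B0 by (simp add: abs_mult mult_mono)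
    qed
    ultimately have "\<bar>x \<bullet> e\<bar> * \<bar>(u (x + \<tau> n *\<^sub>R e))\<^sup>2 - (u x)\<^sup>2\<bar> \<le> (R + 1) * ((2 * B) * (L * \<tau> n))"
      by (intro mult_mono) auto
    then have "\<bar>x \<bullet> e\<bar> * \<bar>(u (x + \<tau> n *\<^sub>R e))\<^sup>2 - (u x)\<^sup>2\<bar> / \<tau> n \<le> D"
      using \<tau>[of n] by (simp add: D_def pos_divide_le_eq mult_ac)
    then show ?thesis
      using True \<tau>[of n] by (simp add: f_def h_def abs_mult)
  next
    case False
    then have x: "norm x > R + 1" by simp
    have "norm x - norm (\<tau> n *\<^sub>R e) \<le> norm (x + \<tau> n *\<^sub>R e)"
      by (rule norm_diff_ineq)
    then have "norm (x + \<tau> n *\<^sub>R e) > R"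
      using x e \<tau>[of n] by simp
    then have "x + \<tau> n *\<^sub>R e \<notin> \<Omega>" "x \<notin> \<Omega>" using R x by force+
    then show ?thesis
      using False Vh_zero[OF u] by (simp add: f_def h_def)
  qed
  have "h integrable_on UNIV"
    unfolding h_def using borel_integrable_compact[of "cball (0::real^'n) (R + 1)" "\<lambda>_. 1::real"]
    by (intro integrable_on_mult_right integrable_on_lborel) simp
  then have h_int: "h integrable_on (UNIV - N)"
    by (rule integrable_spike_set) (auto intro: negligible_subset[OF N])
  have f_int: "(f n has_integral - ip0 \<Omega> u u) (UNIV - N)" for n
    using f_UNIV by (rule has_integral_spike_set_eq[THEN iffD1, rotated 2])
      (auto intro: negligible_subset[OF N])
  have "(g has_integral - ip0 \<Omega> u u) (UNIV - N)"
    by (rule has_integral_dominated_convergence[OF f_int h_int _ _ tendsto_const])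
      (use bound lim in auto)
  then have "(g has_integral - ip0 \<Omega> u u) UNIV"
    by (rule has_integral_spike_set_eq[THEN iffD1, rotated 2])
      (auto intro: negligible_subset[OF N])
  then show ?thesis
    unfolding g_def by (simp add: has_integral_restrict_UNIV)
qed

text \<open>Young's inequality applied to \<open>ip0_self_eq_directional\<close>: the integrand is
  at most half of the squared function, which is absorbed on the left, plus
  \<open>2 * s\<^sup>2\<close>, where \<open>\<bar>s\<bar>\<close> is at most \<open>R\<close> times
  the norm of the gradient.\<close>

lemma Poincare:
  assumes u: "u \<in> Vh \<T> \<Omega>" and R: "\<And>x. x \<in> \<Omega> \<Longrightarrow> norm x \<le> R"
  shows "ip0 \<Omega> u u \<le> 4 * R\<^sup>2 * ipgrad \<Omega> u u"
proof -
  obtain e :: "real^'n" where e: "norm e = 1"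
    using norm_Basis nonempty_Basis by blast
  have "((\<lambda>x. - (2 * (x \<bullet> e) * u x * (grad u x \<bullet> e))) has_integral - (- ip0 \<Omega> u u)) \<Omega>"
    by (intro has_integral_neg ip0_self_eq_directional u e)
  moreover have "((\<lambda>x. (1/2) * (u x * u x) + 2 * R\<^sup>2 * (grad u x \<bullet> grad u x)) has_integral
      (1/2) * ip0 \<Omega> u u + 2 * R\<^sup>2 * ipgrad \<Omega> u u) \<Omega>"
    unfolding ip0_def ipgrad_def
    by (intro has_integral_add has_integral_mult_right integrable_integral
        integrable_Vh_mult integrable_Vh_grad u)
  moreover have "- (2 * (x \<bullet> e) * u x * (grad u x \<bullet> e))
      \<le> (1/2) * (u x * u x) + 2 * R\<^sup>2 * (grad u x \<bullet> grad u x)" if "x \<in> \<Omega>" for x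
  proof -
    define s where "s = (x \<bullet> e) * (grad u x \<bullet> e)"
    have "\<bar>x \<bullet> e\<bar> \<le> R" "\<bar>grad u x \<bullet> e\<bar> \<le> norm (grad u x)"
      using Cauchy_Schwarz_ineq2[of x e] Cauchy_Schwarz_ineq2[of "grad u x" e] e R[OF that] by auto
    then have "\<bar>s\<bar> \<le> R * norm (grad u x)"
      unfolding s_def abs_mult by (intro mult_mono) auto
    then have "s\<^sup>2 \<le> R\<^sup>2 * (grad u x \<bullet> grad u x)"
      using abs_le_square_iff[of s "R * norm (grad u x)"]
      by (simp add: power_mult_distrib power2_norm_eq_inner)
    moreover have "0 \<le> (u x + 2 * s)\<^sup>2" by simp
    ultimately show ?thesis
      by (simp add: s_def power2_eq_square algebra_simps)
  qed
  ultimately have "- (- ip0 \<Omega> u u) \<le> (1/2) * ip0 \<Omega> u u + 2 * R\<^sup>2 * ipgrad \<Omega> u u"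
    by (rule has_integral_le)
  then show ?thesis by simp
qed

text \<open>Extended by zero to a box around \<open>\<Omega>\<close>, the square of \<open>u\<close>
  is continuous and nonnegative with integral zero.\<close>

lemma Vh_eq_zero_of_ip0:
  assumes u: "u \<in> Vh \<T> \<Omega>" and "ip0 \<Omega> u u = 0"
  shows "u x = 0"
proof (cases "x \<in> \<Omega>")
  case True
  obtain a where a: "\<Omega> \<subseteq> cbox (- a) a"
    using bounded_subset_cbox_symmetric[OF bounded_dom] by blast
  have "((\<lambda>x. u x * u x) has_integral 0) \<Omega>"
    using integrable_integral[OF integrable_Vh_mult[OF u u]] assms(2) by (simp add: ip0_def)
  then have "((\<lambda>x. u x * u x) has_integral 0) (cbox (- a) a)"
    by (rule has_integral_on_superset) (use Vh_zero[OF u] a in auto)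
  moreover have "continuous_on (cbox (- a) a) (\<lambda>x. u x * u x)"
    using continuous_on_subset[OF Vh_continuous[OF u]] by (intro continuous_intros) auto
  moreover have "box (- a) a \<noteq> {}"
    using a open_dom True interior_maximal[of \<Omega> "cbox (- a) a"] by auto
  ultimately have "u x * u x = 0"
    using a True by (intro has_integral_0_cbox_imp_0[where f = "\<lambda>x. u x * u x"]) auto
  then show ?thesis by simp
qed (rule Vh_zero[OF u])

end

subsection \<open>Positive definite matrices and the stiffness matrix\<close>

lemma matvec_cong: "(\<And>q. q \<in> I \<Longrightarrow> x q = y q) \<Longrightarrow> matvec I A x p = matvec I A y p"
  by (simp add: matvec_def)

lemma matvec_matmul: "matvec I (matmul I A B) x p = matvec I A (matvec I B x) p"
  unfolding matvec_def matmul_def sum_distrib_left sum_distrib_right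
  by (subst sum.swap) (simp add: mult.assoc)

lemma matvec_adjoint:
  assumes "\<And>p q. A p q = A q p"
  shows "(\<Sum>p\<in>I. x p * matvec I A y p) = (\<Sum>p\<in>I. matvec I A x p * y p)"
proof -
  have "(\<Sum>p\<in>I. x p * matvec I A y p) = (\<Sum>p\<in>I. \<Sum>q\<in>I. x p * A p q * y q)"
    by (simp add: matvec_def sum_distrib_left mult.assoc)
  also have "\<dots> = (\<Sum>q\<in>I. \<Sum>p\<in>I. x p * A p q * y q)"
    by (rule sum.swap)
  also have "\<dots> = (\<Sum>q\<in>I. \<Sum>p\<in>I. A q p * x p * y q)"
    by (simp only: assms mult_ac)
  also have "\<dots> = (\<Sum>q\<in>I. matvec I A x q * y q)"
    by (simp add: matvec_def sum_distrib_right)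
  finally show ?thesis .
qed

text \<open>The induction step works because the Schur complement of a principal block is positive.\<close>
lemma posdef_solvable:
  fixes A :: "'i \<Rightarrow> 'i \<Rightarrow> real"
  assumes "finite I" and "\<And>x. \<exists>p\<in>I. x p \<noteq> 0 \<Longrightarrow> 0 < (\<Sum>p\<in>I. x p * matvec I A x p)"
  shows "\<exists>x. \<forall>p\<in>I. matvec I A x p = b p"
  using assms
proof (induction I arbitrary: b rule: finite_induct)
  case empty
  then show ?case by simp
next
  case (insert a I)
  have mv: "matvec (insert a I) A x p = A p a * x a + matvec I A x p" for x p
    using insert.hyps by (simp add: matvec_def)
  have pos: "0 < (\<Sum>p\<in>I. x p * matvec I A x p)" if "\<exists>p\<in>I. x p \<noteq> 0" for x
  proof -
    \<comment> \<open>Extension by zero shows that positivity passes to the principal block on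
      \<open>I\<close>.\<close>
    define y where "y = x(a := 0)"
    have y: "y p = x p" if "p \<in> I" for p
      using that insert.hyps by (auto simp: y_def)
    then have mvy: "matvec I A y p = matvec I A x p" for p
      by (rule matvec_cong)
    have "0 < (\<Sum>p\<in>insert a I. y p * matvec (insert a I) A y p)"
      using that y by (intro insert.prems) auto
    also have "\<dots> = (\<Sum>p\<in>I. x p * matvec I A x p)"
      using insert.hyps y mvy by (simp add: mv) (simp add: y_def)
    finally show ?thesis .
  qed
  obtain z where z: "\<And>p. p \<in> I \<Longrightarrow> matvec I A z p = A p a"
    using insert.IH[OF pos, of "\<lambda>p. A p a"] by auto
  obtain w where w: "\<And>p. p \<in> I \<Longrightarrow> matvec I A w p = b p"
    using insert.IH[OF pos, of b] by auto
  define s where "s = A a a - matvec I A z a"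
  have upd: "matvec I A ((\<lambda>q. f q)(a := t)) p = matvec I A f p" for f t p
    using insert.hyps by (intro matvec_cong) auto
  have lin: "matvec I A (\<lambda>q. w q - t * z q) p = matvec I A w p - t * matvec I A z p" for t p
    by (simp add: matvec_def sum_subtractf sum_distrib_left algebra_simps)
  have neg: "matvec I A (\<lambda>q. - z q) p = - matvec I A z p" for p
    by (simp add: matvec_def sum_negf)
  \<comment> \<open>The product of the matrix with \<open>v\<close> vanishes on \<open>I\<close>, so
    the form at \<open>v\<close> reduces to its \<open>a\<close> component, which is
    \<open>s\<close>.\<close>
  define v where "v = (\<lambda>q. - z q)(a := 1)"
  have "0 < (\<Sum>p\<in>insert a I. v p * matvec (insert a I) A v p)"
    by (intro insert.prems) (auto simp: v_def)
  also have "\<dots> = s"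
    using insert.hyps z by (simp add: mv v_def upd neg s_def)
  finally have s: "s > 0" .
  \<comment> \<open>Block elimination: the row of \<open>a\<close> determines the component
    \<open>t\<close>, and \<open>w - t * z\<close> then solves the rows in \<open>I\<close>.\<close>
  define t where "t = (b a - matvec I A w a) / s"
  define x where "x = (\<lambda>q. w q - t * z q)(a := t)"
  have "matvec (insert a I) A x p = b p" if "p \<in> insert a I" for p
  proof (cases "p = a")
    case True
    have "matvec (insert a I) A x a = t * s + matvec I A w a"
      by (simp add: mv x_def upd lin s_def algebra_simps)
    also have "\<dots> = b a" using s by (simp add: t_def)
    finally show ?thesis using True by simp
  next
    case False
    then show ?thesis
      using that z w by (simp add: mv x_def upd lin)
  qed
  then show ?case by blast
qed

text \<open>This justifies the definite description in \<open>matinv\<close>: the columns come from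
  \<open>posdef_solvable\<close>, and the difference of two candidate columns lies in the kernel,
  where the form would be zero.\<close>

lemma posdef_matinv:
  fixes A :: "'i \<Rightarrow> 'i \<Rightarrow> real"
  assumes "finite I" and pos: "\<And>x. \<exists>p\<in>I. x p \<noteq> 0 \<Longrightarrow> 0 < (\<Sum>p\<in>I. x p * matvec I A x p)"
  shows posdef_matinv_right: "\<And>p q. p \<in> I \<Longrightarrow> q \<in> I \<Longrightarrow> matmul I A (matinv I A) p q = (if p = q then 1 else 0)"
    and posdef_matinv_outside: "\<And>p q. p \<notin> I \<or> q \<notin> I \<Longrightarrow> matinv I A p q = 0"
proof -
  let ?P = "\<lambda>B. (\<forall>p\<in>I. \<forall>q\<in>I. matmul I A B p q = (if p = q then 1 else 0)) \<and>
    (\<forall>p q. p \<notin> I \<or> q \<notin> I \<longrightarrow> B p q = 0)"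
  have "\<exists>x. \<forall>p\<in>I. matvec I A x p = (if p = q then 1 else 0)" for q
    using posdef_solvable[OF assms] .
  then obtain X where X: "\<And>q p. p \<in> I \<Longrightarrow> matvec I A (X q) p = (if p = q then 1 else 0)"
    by metis
  have ex: "?P (\<lambda>p q. if p \<in> I \<and> q \<in> I then X q p else 0)"
    using X by (auto simp: matmul_def matvec_def cong: sum.cong)
  have uniq: "B = B'" if "?P B" "?P B'" for B B'
  proof (intro ext)
    fix r q
    show "B r q = B' r q"
    proof (cases "r \<in> I \<and> q \<in> I")
      case True
      define x where "x p = B p q - B' p q" for p
      have "matvec I A x p = 0" if "p \<in> I" for p
      proof -
        have "matvec I A x p = matmul I A B p q - matmul I A B' p q"
          by (simp add: x_def matvec_def matmul_def algebra_simps sum_subtractf)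
        then show ?thesis
          using \<open>?P B\<close> \<open>?P B'\<close> True that by simp
      qed
      then have "\<not> 0 < (\<Sum>p\<in>I. x p * matvec I A x p)" by simp
      then have "x r = 0" using pos True by blast
      then show ?thesis by (simp add: x_def)
    next
      case False
      then show ?thesis using that by metis
    qed
  qed
  have "?P (matinv I A)"
    unfolding matinv_def by (rule theI[of ?P, OF ex]) (rule uniq[OF _ ex])
  then show "\<And>p q. p \<in> I \<Longrightarrow> q \<in> I \<Longrightarrow> matmul I A (matinv I A) p q = (if p = q then 1 else 0)"
    and "\<And>p q. p \<notin> I \<or> q \<notin> I \<Longrightarrow> matinv I A p q = 0"
    by blast+
qed

text \<open>Both entries are the value of the symmetric form of \<open>A\<close> at columns
  \<open>p\<close> and \<open>q\<close> of the inverse, evaluated by applying \<open>A\<close> to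
  one column or to the other.\<close>

lemma matinv_symmetric:
  fixes A :: "'i \<Rightarrow> 'i \<Rightarrow> real"
  assumes "finite I" and pos: "\<And>x. \<exists>p\<in>I. x p \<noteq> 0 \<Longrightarrow> 0 < (\<Sum>p\<in>I. x p * matvec I A x p)"
    and sym: "\<And>p q. A p q = A q p"
  shows "matinv I A p q = matinv I A q p"
proof (cases "p \<in> I \<and> q \<in> I")
  case True
  define B where "B = matinv I A"
  have B: "matvec I A (\<lambda>r. B r q) p = (if p = q then 1 else 0)" if "p \<in> I" "q \<in> I" for p q
    using posdef_matinv_right[OF assms(1) pos that] by (simp add: matvec_def matmul_def B_def)
  have "B q p = (\<Sum>r\<in>I. B r p * matvec I A (\<lambda>r. B r q) r)"
    using True assms(1) B by (simp add: if_distrib[where f = "\<lambda>x. _ * x"] cong: if_cong)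
  also have "\<dots> = (\<Sum>r\<in>I. matvec I A (\<lambda>r. B r p) r * B r q)"
    by (rule matvec_adjoint[OF sym])
  also have "\<dots> = B p q"
    using True assms(1) B by (simp add: if_distrib[where f = "\<lambda>x. x * _"] cong: if_cong)
  finally show ?thesis by (simp add: B_def)
next
  case False
  then show ?thesis
    using posdef_matinv_outside[OF assms(1) pos] by metis
qed

lemma matvec_matinv:
  fixes A :: "'i \<Rightarrow> 'i \<Rightarrow> real"
  assumes "finite I" and pos: "\<And>x. \<exists>p\<in>I. x p \<noteq> 0 \<Longrightarrow> 0 < (\<Sum>p\<in>I. x p * matvec I A x p)"
    and "p \<in> I"
  shows "matvec I A (matvec I (matinv I A) b) p = b p"
proof -
  have "matvec I A (matvec I (matinv I A) b) p = (\<Sum>q\<in>I. (if p = q then 1 else 0) * b q)"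
    unfolding matvec_matmul[symmetric] using posdef_matinv_right[OF assms(1) pos assms(3)]
    by (simp add: matvec_def)
  then show ?thesis
    using assms by (simp add: if_distrib[where f = "\<lambda>x. x * _"] cong: if_cong)
qed

text \<open>The imaginary part compares the form with its transpose: it vanishes for symmetric
  \<open>R\<close>, but must be kept for products such as \<open>K D M\<close> that need not be
  symmetric.\<close>

lemma complex_quadratic_form:
  fixes R :: "'i \<Rightarrow> 'i \<Rightarrow> real" and x :: "'i \<Rightarrow> complex"
  defines "a \<equiv> \<lambda>p. Re (x p)" and "b \<equiv> \<lambda>p. Im (x p)"
  shows "(\<Sum>p\<in>I. \<Sum>q\<in>I. cnj (x p) * complex_of_real (R p q) * x q) =
    Complex ((\<Sum>p\<in>I. a p * matvec I R a p) + (\<Sum>p\<in>I. b p * matvec I R b p))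
      ((\<Sum>p\<in>I. a p * matvec I R b p) - (\<Sum>p\<in>I. b p * matvec I R a p))"
proof (rule complex_eqI)
  show "Re (\<Sum>p\<in>I. \<Sum>q\<in>I. cnj (x p) * complex_of_real (R p q) * x q) = Re (Complex
      ((\<Sum>p\<in>I. a p * matvec I R a p) + (\<Sum>p\<in>I. b p * matvec I R b p))
      ((\<Sum>p\<in>I. a p * matvec I R b p) - (\<Sum>p\<in>I. b p * matvec I R a p)))"
    by (simp add: a_def b_def matvec_def sum_distrib_left sum.distrib[symmetric] algebra_simps)
  show "Im (\<Sum>p\<in>I. \<Sum>q\<in>I. cnj (x p) * complex_of_real (R p q) * x q) = Im (Complex
      ((\<Sum>p\<in>I. a p * matvec I R a p) + (\<Sum>p\<in>I. b p * matvec I R b p))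
      ((\<Sum>p\<in>I. a p * matvec I R b p) - (\<Sum>p\<in>I. b p * matvec I R a p)))"
    by (simp add: a_def b_def matvec_def sum_distrib_left sum_subtractf[symmetric] algebra_simps)
qed

section \<open>Coefficient vectors and finite element functions\<close>

context fe_mesh begin

text \<open>The inverse of passing to nodal coefficients; it translates matrix expressions into
  inner products of functions.\<close>

definition fe_fun :: "(real^'n \<Rightarrow> real) \<Rightarrow> real^'n \<Rightarrow> real" where
  "fe_fun x = (\<lambda>z. \<Sum>p\<in>nodes \<T> \<Omega>. x p * hat \<T> \<Omega> p z)"

lemma fe_fun_in_Vh: "fe_fun x \<in> Vh \<T> \<Omega>"
  unfolding fe_fun_def by (intro Vh_lincomb hat_in_Vh)

lemma fe_fun_node:
  assumes "q \<in> nodes \<T> \<Omega>" shows "fe_fun x q = x q"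
proof -
  have "fe_fun x q = (\<Sum>p\<in>nodes \<T> \<Omega>. x p * (if q = p then 1 else 0))"
    unfolding fe_fun_def using assms hat_node by (intro sum.cong) auto
  then show ?thesis
    using assms finite_nodes by (simp add: if_distrib[where f = "\<lambda>x. _ * x"] cong: if_cong)
qed

lemma ip0_fe_fun:
  "ip0 \<Omega> (fe_fun a) (fe_fun b) = (\<Sum>p\<in>nodes \<T> \<Omega>. a p * matvec (nodes \<T> \<Omega>) (mass \<T> \<Omega>) b p)"
proof -
  have "ip0 \<Omega> (hat \<T> \<Omega> p) (fe_fun b) = matvec (nodes \<T> \<Omega>) (mass \<T> \<Omega>) b p" if "p \<in> nodes \<T> \<Omega>" for p
    unfolding ip0_commute[of \<Omega> "hat \<T> \<Omega> p"] fe_fun_def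
    using that by (subst ip0_lincomb_left) (auto simp: finite_nodes hat_in_Vh matvec_def mass_def mult.commute)
  moreover have "ip0 \<Omega> (fe_fun a) (fe_fun b) = (\<Sum>p\<in>nodes \<T> \<Omega>. a p * ip0 \<Omega> (hat \<T> \<Omega> p) (fe_fun b))"
    unfolding fe_fun_def[of a] by (intro ip0_lincomb_left finite_nodes hat_in_Vh fe_fun_in_Vh)
  ultimately show ?thesis by simp
qed

lemma ipgrad_fe_fun:
  "ipgrad \<Omega> (fe_fun a) (fe_fun b) = (\<Sum>p\<in>nodes \<T> \<Omega>. a p * matvec (nodes \<T> \<Omega>) (stiff \<T> \<Omega>) b p)"
proof -
  have "ipgrad \<Omega> (hat \<T> \<Omega> p) (fe_fun b) = matvec (nodes \<T> \<Omega>) (stiff \<T> \<Omega>) b p" if "p \<in> nodes \<T> \<Omega>" for p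
    unfolding ipgrad_commute[of \<Omega> "hat \<T> \<Omega> p"] fe_fun_def
    using that by (subst ipgrad_lincomb_left) (auto simp: finite_nodes hat_in_Vh matvec_def stiff_def mult.commute)
  moreover have "ipgrad \<Omega> (fe_fun a) (fe_fun b) = (\<Sum>p\<in>nodes \<T> \<Omega>. a p * ipgrad \<Omega> (hat \<T> \<Omega> p) (fe_fun b))"
    unfolding fe_fun_def[of a] by (intro ipgrad_lincomb_left finite_nodes hat_in_Vh fe_fun_in_Vh)
  ultimately show ?thesis by simp
qed

lemma norm0_fe_fun_le:
  "(norm0 \<Omega> (fe_fun a))\<^sup>2 \<le> unit_ball_vol (real CARD('n)) * meshsize \<T> ^ CARD('n) * (\<Sum>p\<in>nodes \<T> \<Omega>. (a p)\<^sup>2)"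
  using ip0_self_le_nodes[OF fe_fun_in_Vh, of a] ip0_self_nonneg[of \<Omega> "fe_fun a"]
  by (simp add: norm0_def fe_fun_node cong: sum.cong)

text \<open>By the Poincare inequality, a vanishing gradient form forces the function, hence every
  nodal value, to be zero.\<close>

lemma stiff_posdef:
  assumes "\<exists>p\<in>nodes \<T> \<Omega>. x p \<noteq> 0"
  shows "0 < (\<Sum>p\<in>nodes \<T> \<Omega>. x p * matvec (nodes \<T> \<Omega>) (stiff \<T> \<Omega>) x p)"
proof -
  obtain R where R: "\<And>x. x \<in> \<Omega> \<Longrightarrow> norm x \<le> R"
    using bounded_dom bounded_iff by blast
  have "ipgrad \<Omega> (fe_fun x) (fe_fun x) \<noteq> 0"
  proof
    assume "ipgrad \<Omega> (fe_fun x) (fe_fun x) = 0"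
    then have "ip0 \<Omega> (fe_fun x) (fe_fun x) = 0"
      using Poincare[OF fe_fun_in_Vh R, of x] ip0_self_nonneg[of \<Omega> "fe_fun x"] by simp
    then have "fe_fun x p = 0" for p
      by (rule Vh_eq_zero_of_ip0[OF fe_fun_in_Vh])
    then show False
      using assms fe_fun_node[of _ x] by metis
  qed
  then show ?thesis
    unfolding ipgrad_fe_fun[symmetric] using ipgrad_self_nonneg[of \<Omega> "fe_fun x"] by simp
qed

text \<open>Energy argument: testing the equation with \<open>y\<close> gives
  \<open>g\<^sup>2 \<le> n * m\<close>, and Poincare bounds \<open>n\<close> by
  \<open>2 * R * g\<close>. Cancelling \<open>g\<close> gives the share \<open>2 * R\<close> for the
  gradient; Poincare once more gives \<open>4 * R\<^sup>2\<close> for the function.\<close>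

lemma norm1_solution_le:
  assumes R: "\<And>x. x \<in> \<Omega> \<Longrightarrow> norm x \<le> R" and "0 \<le> R"
    and y: "\<And>p. p \<in> nodes \<T> \<Omega> \<Longrightarrow>
      matvec (nodes \<T> \<Omega>) (stiff \<T> \<Omega>) y p = matvec (nodes \<T> \<Omega>) (mass \<T> \<Omega>) a p"
  shows "norm1 \<Omega> (fe_fun y) \<le> (2 * R + 4 * R\<^sup>2) * norm0 \<Omega> (fe_fun a)"
proof -
  define g where "g = sqrt (ipgrad \<Omega> (fe_fun y) (fe_fun y))"
  define n where "n = norm0 \<Omega> (fe_fun y)"
  define m where "m = norm0 \<Omega> (fe_fun a)"
  have g: "0 \<le> g" "g\<^sup>2 = ipgrad \<Omega> (fe_fun y) (fe_fun y)"
    using ipgrad_self_nonneg[of \<Omega> "fe_fun y"] by (auto simp: g_def)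
  have n: "0 \<le> n" "n\<^sup>2 = ip0 \<Omega> (fe_fun y) (fe_fun y)" and m: "0 \<le> m"
    using ip0_self_nonneg[of \<Omega> "fe_fun y"] ip0_self_nonneg[of \<Omega> "fe_fun a"]
    by (auto simp: n_def m_def norm0_def)
  have ng: "n \<le> 2 * R * g"
  proof (rule power2_le_imp_le)
    show "n\<^sup>2 \<le> (2 * R * g)\<^sup>2"
      using Poincare[OF fe_fun_in_Vh R, of y] g n by (simp add: power_mult_distrib)
  qed (use \<open>0 \<le> R\<close> g in auto)
  have "g\<^sup>2 = ip0 \<Omega> (fe_fun y) (fe_fun a)"
    using y by (simp add: g ipgrad_fe_fun ip0_fe_fun cong: sum.cong)
  also have "\<dots> \<le> n * m"
    using ip0_Cauchy_Schwarz[OF fe_fun_in_Vh fe_fun_in_Vh, of y a] by (simp add: n_def m_def)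
  also have "\<dots> \<le> 2 * R * g * m"
    using ng m by (rule mult_right_mono)
  finally have "g * g \<le> (2 * R * m) * g"
    by (simp add: power2_eq_square mult_ac)
  then have gm: "g \<le> 2 * R * m"
    using g m \<open>0 \<le> R\<close> by (cases "g = 0") auto
  have nm: "n \<le> 4 * R\<^sup>2 * m"
    using ng mult_left_mono[OF gm, of "2 * R"] \<open>0 \<le> R\<close> by (simp add: power2_eq_square)
  have "norm1 \<Omega> (fe_fun y) = sqrt (n\<^sup>2 + g\<^sup>2)"
    by (simp add: norm1_def g n)
  also have "\<dots> \<le> n + g"
    using n(1) g(1) by (rule sqrt_sum_squares_le_sum)
  also have "\<dots> \<le> (2 * R + 4 * R\<^sup>2) * m"
    using nm gm by (simp add: algebra_simps)
  finally show ?thesis by (simp add: m_def)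
qed

end

subsection \<open>Bounds for the residual forms\<close>

context fe_mesh begin

text \<open>The stiffness form is bounded at pairs of vectors, since \<open>K D M\<close> need not
  be symmetric and its mixed values enter the imaginary part. For the symmetric \<open>M D M\<close>
  the diagonal values suffice.\<close>

lemma residual_forms_bound:
  fixes Kt :: "real^'n \<Rightarrow> real^'n \<Rightarrow> real"
  defines "I \<equiv> nodes \<T> \<Omega>" and "K \<equiv> stiff \<T> \<Omega>" and "M \<equiv> mass \<T> \<Omega>"
  defines "D \<equiv> \<lambda>i j. Kt i j - matinv I K i j"
  assumes Kt: "\<forall>p q. Kt p q = Kt q p"
    and E: "\<forall>u\<in>Vh \<T> \<Omega>. \<forall>Eu\<in>Vh \<T> \<Omega>.
      (\<forall>p\<in>I. coef \<T> \<Omega> Eu p = matvec I (matmul I D K) (coef \<T> \<Omega> u) p) \<longrightarrow>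
      norm1 \<Omega> Eu \<le> c1 * norm1 \<Omega> u \<and> norm0 \<Omega> Eu \<le> c0 * norm0 \<Omega> u"
    and R: "\<forall>x\<in>\<Omega>. norm x \<le> R" "0 \<le> R" and c1: "0 \<le> c1"
  shows residual_symmetric: "D p q = D q p"
    and residual_form_stiff: "\<bar>\<Sum>p\<in>I. a p * matvec I (matmul I (matmul I K D) M) b p\<bar>
      \<le> c0 * norm0 \<Omega> (fe_fun a) * norm0 \<Omega> (fe_fun b)"
    and residual_form_mass: "\<bar>\<Sum>p\<in>I. a p * matvec I (matmul I (matmul I M D) M) a p\<bar>
      \<le> c1 * (2 * R + 4 * R\<^sup>2) * (norm0 \<Omega> (fe_fun a))\<^sup>2"
proof -
  have sym: "D p q = D q p" for p q
    using Kt[rule_format, of p q] matinv_symmetric[OF finite_nodes stiff_posdef stiff_commute, of p q]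
    by (simp add: D_def I_def K_def)
  then show "D p q = D q p" .
  have coef: "coef \<T> \<Omega> (fe_fun x) p = x p" if "p \<in> I" for x p
    using that fe_fun_node by (simp add: coef_def I_def)
  \<comment> \<open>The error hypothesis rephrased for coefficient vectors: \<open>fe_fun\<close> of
    \<open>D K x\<close> has the prescribed coefficients.\<close>
  have E': "norm1 \<Omega> (fe_fun (matvec I D (matvec I K x))) \<le> c1 * norm1 \<Omega> (fe_fun x) \<and>
      norm0 \<Omega> (fe_fun (matvec I D (matvec I K x))) \<le> c0 * norm0 \<Omega> (fe_fun x)" for x
  proof (rule E[rule_format, OF fe_fun_in_Vh fe_fun_in_Vh])
    fix p assume p: "p \<in> I"
    have "matvec I (matmul I D K) (coef \<T> \<Omega> (fe_fun x)) p = matvec I (matmul I D K) x p"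
      using coef by (rule matvec_cong)
    then show "coef \<T> \<Omega> (fe_fun (matvec I D (matvec I K x))) p
        = matvec I (matmul I D K) (coef \<T> \<Omega> (fe_fun x)) p"
      using coef[OF p] by (simp add: matvec_matmul)
  qed
  show "\<bar>\<Sum>p\<in>I. a p * matvec I (matmul I (matmul I K D) M) b p\<bar>
      \<le> c0 * norm0 \<Omega> (fe_fun a) * norm0 \<Omega> (fe_fun b)"
  proof -
    \<comment> \<open>Symmetry of \<open>K\<close> and \<open>D\<close> moves both to the left
      factor, where \<open>D K a\<close> is the error applied to \<open>a\<close>.\<close>
    have "(\<Sum>p\<in>I. a p * matvec I (matmul I (matmul I K D) M) b p)
        = (\<Sum>p\<in>I. matvec I D (matvec I K a) p * matvec I M b p)"
      unfolding matvec_matmul K_def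
      by (simp only: matvec_adjoint[of "stiff \<T> \<Omega>", OF stiff_commute] matvec_adjoint[of D, OF sym])
    also have "\<dots> = ip0 \<Omega> (fe_fun (matvec I D (matvec I K a))) (fe_fun b)"
      by (simp add: ip0_fe_fun I_def M_def)
    also have "\<bar>\<dots>\<bar> \<le> norm0 \<Omega> (fe_fun (matvec I D (matvec I K a))) * norm0 \<Omega> (fe_fun b)"
      by (rule ip0_Cauchy_Schwarz[OF fe_fun_in_Vh fe_fun_in_Vh])
    also have "\<dots> \<le> c0 * norm0 \<Omega> (fe_fun a) * norm0 \<Omega> (fe_fun b)"
      using E'[of a] by (intro mult_right_mono) auto
    finally show ?thesis .
  qed
  show "\<bar>\<Sum>p\<in>I. a p * matvec I (matmul I (matmul I M D) M) a p\<bar>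
      \<le> c1 * (2 * R + 4 * R\<^sup>2) * (norm0 \<Omega> (fe_fun a))\<^sup>2"
  proof -
    define y where "y = matvec I (matinv I K) (matvec I M a)"
    have y: "matvec I K y p = matvec I M a p" if "p \<in> I" for p
      using that matvec_matinv[OF finite_nodes stiff_posdef] by (simp add: y_def I_def K_def)
    let ?e = "fe_fun (matvec I D (matvec I K y))"
    \<comment> \<open>Replacing \<open>M a\<close> by \<open>K y\<close> makes \<open>D M a\<close>
      an error vector, to which the hypothesis applies.\<close>
    have "matvec I D (matvec I M a) = matvec I D (matvec I K y)"
      using y by (intro ext matvec_cong) simp
    then have "(\<Sum>p\<in>I. a p * matvec I (matmul I (matmul I M D) M) a p)
        = (\<Sum>p\<in>I. a p * matvec I M (matvec I D (matvec I K y)) p)"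
      by (simp add: matvec_matmul)
    also have "\<dots> = ip0 \<Omega> (fe_fun a) ?e"
      by (simp add: ip0_fe_fun I_def M_def)
    also have "\<bar>\<dots>\<bar> \<le> norm0 \<Omega> (fe_fun a) * norm0 \<Omega> ?e"
      by (rule ip0_Cauchy_Schwarz[OF fe_fun_in_Vh fe_fun_in_Vh])
    also have "\<dots> \<le> norm0 \<Omega> (fe_fun a) * (c1 * ((2 * R + 4 * R\<^sup>2) * norm0 \<Omega> (fe_fun a)))"
    proof (intro mult_left_mono norm0_nonneg)
      have "norm0 \<Omega> ?e \<le> c1 * norm1 \<Omega> (fe_fun y)"
        using norm0_le_norm1 E' order_trans by blast
      also have "\<dots> \<le> c1 * ((2 * R + 4 * R\<^sup>2) * norm0 \<Omega> (fe_fun a))"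
        using y R c1 unfolding I_def K_def M_def by (intro mult_left_mono norm1_solution_le) auto
      finally show "norm0 \<Omega> ?e \<le> c1 * ((2 * R + 4 * R\<^sup>2) * norm0 \<Omega> (fe_fun a))" .
    qed
    finally show ?thesis by (simp add: power2_eq_square mult_ac)
  qed
qed

end

text \<open>The product splits into \<open>K D M\<close> and a complex multiple of
  \<open>M D M\<close>. The form of the latter is real by symmetry, so \<open>\<kappa>\<close>
  enters only the real part and \<open>\<sigma>\<close> only the imaginary part.\<close>

lemma helm_product_form:
  fixes D :: "real^'n \<Rightarrow> real^'n \<Rightarrow> real" and x :: "real^'n \<Rightarrow> complex"
    and I :: "(real^'n) set" and \<T> :: "(real^'n) set set" and \<Omega> :: "(real^'n) set"
  defines "a \<equiv> \<lambda>p. Re (x p)" and "b \<equiv> \<lambda>p. Im (x p)"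
  defines "qf \<equiv> \<lambda>L f g. \<Sum>p\<in>I. f p * matvec I (matmul I (matmul I L D) (mass \<T> \<Omega>)) g p"
  assumes D: "\<And>p q. D p q = D q p"
  shows "(\<Sum>p\<in>I. \<Sum>q\<in>I. cnj (x p) *
      matmul I (matmul I (helm \<kappa> \<sigma> \<T> \<Omega>) (\<lambda>i j. complex_of_real (D i j)))
        (\<lambda>i j. complex_of_real (mass \<T> \<Omega> i j)) p q * x q) =
    Complex (qf (stiff \<T> \<Omega>) a a + qf (stiff \<T> \<Omega>) b b - \<kappa>\<^sup>2 * (qf (mass \<T> \<Omega>) a a + qf (mass \<T> \<Omega>) b b))
      (qf (stiff \<T> \<Omega>) a b - qf (stiff \<T> \<Omega>) b a + \<sigma> * (qf (mass \<T> \<Omega>) a a + qf (mass \<T> \<Omega>) b b))"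
proof -
  let ?K = "stiff \<T> \<Omega>" and ?M = "mass \<T> \<Omega>"
  define S where "S = matmul I (matmul I ?K D) ?M"
  define Q where "Q = matmul I (matmul I ?M D) ?M"
  have entry: "matmul I (matmul I (helm \<kappa> \<sigma> \<T> \<Omega>) (\<lambda>i j. complex_of_real (D i j)))
        (\<lambda>i j. complex_of_real (?M i j)) p q
      = complex_of_real (S p q) + (\<i> * \<sigma> - \<kappa>\<^sup>2) * complex_of_real (Q p q)" for p q
    by (simp add: S_def Q_def matmul_def helm_def sum_distrib_left sum_distrib_right
        sum.distrib[symmetric] sum_subtractf[symmetric] algebra_simps)
  have Qsym: "qf ?M a b = qf ?M b a"
  proof -
    have "qf ?M a b = (\<Sum>p\<in>I. matvec I ?M (matvec I D (matvec I ?M a)) p * b p)"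
      unfolding qf_def matvec_matmul
      by (simp only: matvec_adjoint[of ?M, OF mass_commute] matvec_adjoint[of D, OF D])
    then show ?thesis
      by (simp add: qf_def matvec_matmul mult.commute)
  qed
  have "(\<Sum>p\<in>I. \<Sum>q\<in>I. cnj (x p) *
      matmul I (matmul I (helm \<kappa> \<sigma> \<T> \<Omega>) (\<lambda>i j. complex_of_real (D i j)))
        (\<lambda>i j. complex_of_real (?M i j)) p q * x q)
    = (\<Sum>p\<in>I. \<Sum>q\<in>I. cnj (x p) * complex_of_real (S p q) * x q)
      + (\<i> * \<sigma> - \<kappa>\<^sup>2) * (\<Sum>p\<in>I. \<Sum>q\<in>I. cnj (x p) * complex_of_real (Q p q) * x q)"
    unfolding entry by (simp add: sum_distrib_left sum.distrib[symmetric] algebra_simps)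
  also have "\<dots> = Complex (qf ?K a a + qf ?K b b) (qf ?K a b - qf ?K b a)
      + (\<i> * \<sigma> - \<kappa>\<^sup>2) * Complex (qf ?M a a + qf ?M b b) (qf ?M a b - qf ?M b a)"
    unfolding complex_quadratic_form qf_def S_def Q_def a_def b_def ..
  finally show ?thesis
    unfolding Qsym by (simp add: complex_eq_iff Re_power2 Im_power2)
qed

section \<open>The bound for the numerical range\<close>

theorem theorem5:
  fixes \<Omega> :: "(real^'n) set" and \<rho> CE :: real
  assumes dim: "CARD('n) = 2 \<or> CARD('n) = 3"
    and dom: "polyhedral_domain \<Omega>"
    and rho: "\<rho> > 0" and CE: "CE > 0"
  shows "\<exists>C>0. \<forall>(\<T> :: (real^'n) set set) (\<kappa>::real) (\<sigma>::real) (N::nat)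
              (Kt :: real^'n \<Rightarrow> real^'n \<Rightarrow> real) (\<gamma>0::real) (\<gamma>1::real).
     mesh_of \<T> \<Omega> \<and> quasi_uniform \<rho> \<T> \<and> \<sigma> > 0 \<and>
     0 \<le> \<gamma>0 \<and> \<gamma>0 < 1 \<and> 0 \<le> \<gamma>1 \<and> \<gamma>1 < 1 \<and>
     (\<forall>p q. Kt p q = Kt q p) \<and>
     (\<forall>u\<in>Vh \<T> \<Omega>. \<forall>Eu\<in>Vh \<T> \<Omega>.
        (\<forall>p\<in>nodes \<T> \<Omega>. coef \<T> \<Omega> Eu p =
            matvec (nodes \<T> \<Omega>)
              (matmul (nodes \<T> \<Omega>) (\<lambda>i j. Kt i j - matinv (nodes \<T> \<Omega>) (stiff \<T> \<Omega>) i j) (stiff \<T> \<Omega>))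
              (coef \<T> \<Omega> u) p) \<longrightarrow>
        norm1 \<Omega> Eu \<le> CE * \<gamma>1 ^ N * norm1 \<Omega> u \<and>
        norm0 \<Omega> Eu \<le> CE * \<gamma>0 ^ N * norm0 \<Omega> u)
     \<longrightarrow>
     (let I = nodes \<T> \<Omega>; h = meshsize \<T>;
          B = matmul I (matmul I (helm \<kappa> \<sigma> \<T> \<Omega>)
                 (\<lambda>i j. complex_of_real (Kt i j - matinv I (stiff \<T> \<Omega>) i j)))
                 (\<lambda>i j. complex_of_real (mass \<T> \<Omega> i j))
      in Re ` num_range I B \<subseteq> {- C * h ^ CARD('n) * (\<gamma>0 ^ N + \<kappa>\<^sup>2 * \<gamma>1 ^ N) ..
                                  C * h ^ CARD('n) * (\<gamma>0 ^ N + \<kappa>\<^sup>2 * \<gamma>1 ^ N)} \<and>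
         Im ` num_range I B \<subseteq> {- C * h ^ CARD('n) * (\<gamma>0 ^ N + \<sigma> * \<gamma>1 ^ N) ..
                                  C * h ^ CARD('n) * (\<gamma>0 ^ N + \<sigma> * \<gamma>1 ^ N)})"
proof -
  have "bounded \<Omega>" using dom by (simp add: polyhedral_domain_def)
  then obtain R where R: "0 < R" "\<forall>x\<in>\<Omega>. norm x \<le> R"
    using bounded_pos by metis
  define V where "V = unit_ball_vol (real CARD('n))"
  have V: "V > 0" by (simp add: V_def)
  define P where "P = 2 * R + 4 * R\<^sup>2"
  have P: "P > 0" using R by (simp add: P_def add_pos_nonneg)
  \<comment> \<open>\<open>V\<close> comes from the nodal bound of the norm, \<open>P\<close> from
    the discrete Poisson problem; \<open>1 + P\<close> dominates the factor 1 at the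
    \<open>\<gamma>0\<close> term and the factor \<open>P\<close> at the \<open>\<gamma>1\<close>
    term. All depend only on \<open>\<Omega>\<close>, the dimension and \<open>CE\<close>.\<close>
  define C where "C = CE * V * (1 + P)"
  have C: "C > 0" using CE V P by (simp add: C_def)
  show ?thesis
  proof (intro exI[of _ C] conjI C allI impI, elim conjE)
    fix \<T> :: "(real^'n) set set" and \<kappa> \<sigma> :: real and N :: nat
      and Kt :: "real^'n \<Rightarrow> real^'n \<Rightarrow> real" and \<gamma>0 \<gamma>1 :: real
    assume mesh: "mesh_of \<T> \<Omega>" and \<sigma>: "\<sigma> > 0" and \<gamma>: "0 \<le> \<gamma>0" "0 \<le> \<gamma>1"
      and Kt: "\<forall>p q. Kt p q = Kt q p"
      and E: "\<forall>u\<in>Vh \<T> \<Omega>. \<forall>Eu\<in>Vh \<T> \<Omega>.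
        (\<forall>p\<in>nodes \<T> \<Omega>. coef \<T> \<Omega> Eu p =
            matvec (nodes \<T> \<Omega>)
              (matmul (nodes \<T> \<Omega>) (\<lambda>i j. Kt i j - matinv (nodes \<T> \<Omega>) (stiff \<T> \<Omega>) i j) (stiff \<T> \<Omega>))
              (coef \<T> \<Omega> u) p) \<longrightarrow>
        norm1 \<Omega> Eu \<le> CE * \<gamma>1 ^ N * norm1 \<Omega> u \<and>
        norm0 \<Omega> Eu \<le> CE * \<gamma>0 ^ N * norm0 \<Omega> u"
    interpret fe_mesh \<T> \<Omega>
      using dom mesh by unfold_locales
    define I where "I = nodes \<T> \<Omega>"
    define h where "h = meshsize \<T>"
    define D where "D = (\<lambda>i j. Kt i j - matinv I (stiff \<T> \<Omega>) i j)"
    define B where "B = matmul I (matmul I (helm \<kappa> \<sigma> \<T> \<Omega>) (\<lambda>i j. complex_of_real (D i j)))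
      (\<lambda>i j. complex_of_real (mass \<T> \<Omega> i j))"
    define W where "W = V * h ^ CARD('n)"
    have c: "0 \<le> CE * \<gamma>0 ^ N" "0 \<le> CE * \<gamma>1 ^ N" using CE \<gamma> by auto
    define qf where "qf = (\<lambda>L f g. \<Sum>p\<in>I. f p * matvec I (matmul I (matmul I L D) (mass \<T> \<Omega>)) g p)"
    note forms = residual_forms_bound[OF Kt E R(2) less_imp_le[OF R(1)] c(2),
        folded I_def, folded D_def P_def]
    have D: "D p q = D q p" for p q
      using forms(1)[of p q] by (simp add: D_def)
    have S: "\<bar>qf (stiff \<T> \<Omega>) f g\<bar> \<le> CE * \<gamma>0 ^ N * norm0 \<Omega> (fe_fun f) * norm0 \<Omega> (fe_fun g)" for f g
      unfolding qf_def using forms(2) by blast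
    have Q: "\<bar>qf (mass \<T> \<Omega>) f f\<bar> \<le> CE * \<gamma>1 ^ N * P * (norm0 \<Omega> (fe_fun f))\<^sup>2" for f
      unfolding qf_def using forms(3) by blast
    have bounds: "\<bar>Re z\<bar> \<le> C * h ^ CARD('n) * (\<gamma>0 ^ N + \<kappa>\<^sup>2 * \<gamma>1 ^ N) \<and>
        \<bar>Im z\<bar> \<le> C * h ^ CARD('n) * (\<gamma>0 ^ N + \<sigma> * \<gamma>1 ^ N)" if z: "z \<in> num_range I B" for z
    proof -
      obtain x where x: "\<exists>p\<in>I. x p \<noteq> 0"
        and zx: "z = (\<Sum>p\<in>I. \<Sum>q\<in>I. cnj (x p) * B p q * x q) / complex_of_real (\<Sum>p\<in>I. (cmod (x p))\<^sup>2)"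
        using z unfolding num_range_def by blast
      define a where "a = (\<lambda>p. Re (x p))"
      define b where "b = (\<lambda>p. Im (x p))"
      define X where "X = (\<Sum>p\<in>I. (cmod (x p))\<^sup>2)"
      have X: "X > 0"
      proof -
        obtain p where "p \<in> I" "x p \<noteq> 0" using x by blast
        then show ?thesis
          using finite_nodes unfolding X_def I_def by (intro sum_pos2[of _ p]) auto
      qed
      have zc: "z = Complex (qf (stiff \<T> \<Omega>) a a + qf (stiff \<T> \<Omega>) b b - \<kappa>\<^sup>2 * (qf (mass \<T> \<Omega>) a a + qf (mass \<T> \<Omega>) b b))
          (qf (stiff \<T> \<Omega>) a b - qf (stiff \<T> \<Omega>) b a + \<sigma> * (qf (mass \<T> \<Omega>) a a + qf (mass \<T> \<Omega>) b b))
          / complex_of_real X"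
        unfolding zx B_def helm_product_form[OF D] qf_def a_def b_def X_def ..
      define m where "m = norm0 \<Omega> (fe_fun a)"
      define n where "n = norm0 \<Omega> (fe_fun b)"
      have mn: "m\<^sup>2 + n\<^sup>2 \<le> W * X"
      proof -
        have "m\<^sup>2 + n\<^sup>2 \<le> W * (\<Sum>p\<in>I. (a p)\<^sup>2) + W * (\<Sum>p\<in>I. (b p)\<^sup>2)"
          unfolding m_def n_def W_def V_def h_def I_def by (intro add_mono norm0_fe_fun_le)
        also have "\<dots> = W * X"
          by (simp add: X_def a_def b_def cmod_power2 sum.distrib algebra_simps)
        finally show ?thesis .
      qed
      have Sd: "\<bar>qf (stiff \<T> \<Omega>) a a + qf (stiff \<T> \<Omega>) b b\<bar> \<le> CE * \<gamma>0 ^ N * (m\<^sup>2 + n\<^sup>2)"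
        using S[of a a] S[of b b] by (simp add: m_def n_def power2_eq_square algebra_simps abs_le_iff)
      have So: "\<bar>qf (stiff \<T> \<Omega>) a b - qf (stiff \<T> \<Omega>) b a\<bar> \<le> CE * \<gamma>0 ^ N * (m\<^sup>2 + n\<^sup>2)"
      proof -
        have "\<bar>qf (stiff \<T> \<Omega>) a b - qf (stiff \<T> \<Omega>) b a\<bar> \<le> CE * \<gamma>0 ^ N * (2 * m * n)"
          using S[of a b] S[of b a] by (simp add: m_def n_def algebra_simps abs_le_iff)
        also have "\<dots> \<le> CE * \<gamma>0 ^ N * (m\<^sup>2 + n\<^sup>2)"
          using c sum_squares_bound[of m n] by (intro mult_left_mono) auto
        finally show ?thesis .
      qed
      have Qd: "\<bar>qf (mass \<T> \<Omega>) a a + qf (mass \<T> \<Omega>) b b\<bar> \<le> CE * \<gamma>1 ^ N * P * (m\<^sup>2 + n\<^sup>2)"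
        using Q[of a] Q[of b] by (simp add: m_def n_def algebra_simps abs_le_iff)
      \<comment> \<open>Used with \<open>k = - \<kappa>\<^sup>2\<close> for the real part and
        \<open>k = \<sigma>\<close> for the imaginary part.\<close>
      have combine: "\<bar>s + k * q\<bar> \<le> C * h ^ CARD('n) * (\<gamma>0 ^ N + \<bar>k\<bar> * \<gamma>1 ^ N) * X"
        if s: "\<bar>s\<bar> \<le> CE * \<gamma>0 ^ N * (m\<^sup>2 + n\<^sup>2)" and q: "\<bar>q\<bar> \<le> CE * \<gamma>1 ^ N * P * (m\<^sup>2 + n\<^sup>2)" for s k q
      proof -
        have "\<bar>s + k * q\<bar> \<le> \<bar>s\<bar> + \<bar>k\<bar> * \<bar>q\<bar>"
          using abs_triangle_ineq[of s "k * q"] by (simp add: abs_mult)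
        also have "\<dots> \<le> CE * \<gamma>0 ^ N * (m\<^sup>2 + n\<^sup>2) + \<bar>k\<bar> * (CE * \<gamma>1 ^ N * P * (m\<^sup>2 + n\<^sup>2))"
          using s q by (intro add_mono mult_left_mono) auto
        also have "\<dots> = CE * (\<gamma>0 ^ N + \<bar>k\<bar> * \<gamma>1 ^ N * P) * (m\<^sup>2 + n\<^sup>2)"
          by (simp add: algebra_simps)
        also have "\<dots> \<le> CE * ((\<gamma>0 ^ N + \<bar>k\<bar> * \<gamma>1 ^ N) * (1 + P)) * (W * X)"
        proof (intro mult_mono mn)
          have "0 \<le> P * \<gamma>0 ^ N + \<bar>k\<bar> * \<gamma>1 ^ N" using \<gamma> P by simp
          then show "\<gamma>0 ^ N + \<bar>k\<bar> * \<gamma>1 ^ N * P \<le> (\<gamma>0 ^ N + \<bar>k\<bar> * \<gamma>1 ^ N) * (1 + P)"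
            by (simp add: algebra_simps)
        qed (use CE \<gamma> P in auto)
        also have "\<dots> = C * h ^ CARD('n) * (\<gamma>0 ^ N + \<bar>k\<bar> * \<gamma>1 ^ N) * X"
          by (simp add: C_def W_def)
        finally show ?thesis .
      qed
      show ?thesis
        using combine[OF Sd Qd, of "- \<kappa>\<^sup>2"] combine[OF So Qd, of \<sigma>] X \<sigma>
        by (simp add: zc Re_divide_of_real Im_divide_of_real pos_divide_le_eq)
    qed
    show "let I = nodes \<T> \<Omega>; h = meshsize \<T>;
          B = matmul I (matmul I (helm \<kappa> \<sigma> \<T> \<Omega>)
                 (\<lambda>i j. complex_of_real (Kt i j - matinv I (stiff \<T> \<Omega>) i j)))
                 (\<lambda>i j. complex_of_real (mass \<T> \<Omega> i j))
      in Re ` num_range I B \<subseteq> {- C * h ^ CARD('n) * (\<gamma>0 ^ N + \<kappa>\<^sup>2 * \<gamma>1 ^ N) ..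
                                  C * h ^ CARD('n) * (\<gamma>0 ^ N + \<kappa>\<^sup>2 * \<gamma>1 ^ N)} \<and>
         Im ` num_range I B \<subseteq> {- C * h ^ CARD('n) * (\<gamma>0 ^ N + \<sigma> * \<gamma>1 ^ N) ..
                                  C * h ^ CARD('n) * (\<gamma>0 ^ N + \<sigma> * \<gamma>1 ^ N)}"
      unfolding Let_def I_def[symmetric] h_def[symmetric] D_def[symmetric]
      unfolding fun_cong[OF fun_cong[OF D_def], symmetric] B_def[symmetric]
      by (auto dest!: bounds simp: abs_le_iff)
  qed
qed

end
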